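(* Let $(E'',q'')=(\mathbb Z^3,q'')$ and $(E,q)=(\mathbb Z^3,q)$ be nonsingular integral ternary quadratic modules, $\Delta=\det q/2$, $\Delta''=\det q''/2$, and let $t\in C(E)$, $t''\in C(E'')$ be the special elements. Let $\varphi:C_0(E'')\to C_0(E)$ be a homomorphism of the even subalgebras. Then $\varphi$ coincides with the restriction to $C_0(E'')$ of the lift $\varphi_\alpha:C(E'')\to C(E)$ of some isometry $\alpha:(E'',q'')\to(E,q)$ if and only if $$\varphi(E''\cdot t'')\subset\sqrt{\Delta''/\Delta}\cdot(E\cdot t).$$ In this case the isometry $\alpha$ is unique up to sign and is given by $\alpha(x'')=\pm\varphi(x''t'')\,t/\sqrt{\Delta\Delta''}$ for $x''\in E''$, where either sign may be fixed.
   Context: For a quadratic $\mathbb Z$-module $(E,q)$ with $E=\mathbb Z^3$, standard basis $e_1,e_2,e_3$, $q$ integral nonsingular ternary form, the Clifford algebra $C(E)=C(E,q)$ is the $\mathbb Z$-algebra generated by $E$ subject to $x^2=q(x)\cdot1$ for $x\in E$ (free of rank 8, with basis the products of the $e_i$); $C_0(E)$ is the even subalgebra, spanned by $1,e_2e_3,-e_1e_3,e_1e_2$. $x\mapsto\bar x$ is the antiautomorphism of $C(E)$ with $\bar e_j=-e_j$. The special element is $t=e_1e_2e_3+\overline{e_1e_2e_3}\in C(E)$; it is central and satisfies $t^2=-\Delta$ with $\Delta=\det q/2$ ($\det q$ the determinant of the matrix $Q$ with $2q(X)={}^tXQX$). An isometry $\alpha:(E'',q'')\to(E,q)$ is a $\mathbb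 Z$-linear map with $q(\alpha(x))=q''(x)$; its lift $\varphi_\alpha$ is the unique algebra homomorphism $C(E'')\to C(E)$ extending $\alpha$. The inclusion and formula are interpreted in $C(E)\otimes_{\mathbb Z}\mathbb C$. *)

theory Defs
  imports
    "HOL-Analysis.Determinants"
    "HOL-Algebra.QuotRing"
    "HOL-Algebra.Free_Abelian_Groups"
    "HOL-Algebra.Generated_Groups"
    "HOL-Algebra.Subrings"
begin

section \<open>Ternary quadratic modules\<close>

text \<open>
  A ternary quadratic module \<open>(\<int>\<^sup>3, q)\<close> is given by the function \<open>q\<close>. The matrix \<open>Q\<close> is determined by
  \<open>q\<close>; its diagonal is automatically even, while its off-diagonal entries, which are the coefficients
  of the mixed terms of \<open>q\<close>, are arbitrary integers.
\<close>

definition gram_matrix :: "(int^3 \<Rightarrow> int) \<Rightarrow> int^3^3 \<Rightarrow> bool" where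
  "gram_matrix q Q \<longleftrightarrow>
     (\<forall>i j. Q $ i $ j = Q $ j $ i) \<and>
     (\<forall>x. 2 * q x = (\<Sum>i\<in>UNIV. \<Sum>j\<in>UNIV. x $ i * Q $ i $ j * x $ j))"

definition half_det :: "int^3^3 \<Rightarrow> complex" where
  "half_det Q = of_int (det Q) / 2"

definition isometry :: "(int^3 \<Rightarrow> int) \<Rightarrow> (int^3 \<Rightarrow> int) \<Rightarrow> (int^3 \<Rightarrow> int^3) \<Rightarrow> bool" where
  "isometry q'' q \<alpha> \<longleftrightarrow>
     (\<forall>x y. \<alpha> (x + y) = \<alpha> x + \<alpha> y) \<and> (\<forall>c x. \<alpha> (c *s x) = c *s \<alpha> x) \<and> (\<forall>x. q (\<alpha> x) = q'' x)"


section \<open>The tensor algebra of \<open>\<int>\<^sup>3\<close>\<close>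

instantiation list :: (type) monoid_add
begin

definition zero_list :: "'a list" where "zero_list = []"

definition plus_list :: "'a list \<Rightarrow> 'a list \<Rightarrow> 'a list" where "plus_list = (@)"

instance by standard (simp_all add: zero_list_def plus_list_def)

end

text \<open>
  The free associative unital \<open>\<int>\<close>-algebra on \<open>e\<^sub>1, e\<^sub>2, e\<^sub>3\<close>, that is, the monoid algebra of the
  free monoid on three letters.
\<close>

type_synonym tensor_alg = "3 list \<Rightarrow>\<^sub>0 int"

definition T_alg :: "tensor_alg ring" where
  "T_alg = \<lparr>carrier = UNIV, monoid.mult = (*), one = 1, ring.zero = 0, add = (+)\<rparr>"

definition vec_T :: "int^3 \<Rightarrow> tensor_alg" where
  "vec_T x = (\<Sum>i\<in>UNIV. Poly_Mapping.single [i] (x $ i))"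

text \<open>The antiautomorphism \<open>e\<^bsub>i\<^sub>1\<^esub> \<cdots> e\<^bsub>i\<^sub>k\<^esub> \<mapsto> (-1)\<^sup>k e\<^bsub>i\<^sub>k\<^esub> \<cdots> e\<^bsub>i\<^sub>1\<^esub>\<close>.\<close>

definition conj_T :: "tensor_alg \<Rightarrow> tensor_alg" where
  "conj_T f = (\<Sum>w\<in>Poly_Mapping.keys f. Poly_Mapping.single (rev w) ((- 1) ^ length w * Poly_Mapping.lookup f w))"


section \<open>The Clifford algebra\<close>

definition cliff_ideal :: "(int^3 \<Rightarrow> int) \<Rightarrow> tensor_alg set" where
  "cliff_ideal q = Idl\<^bsub>T_alg\<^esub> {vec_T x * vec_T x - of_int (q x) |x. True}"

definition cliff :: "(int^3 \<Rightarrow> int) \<Rightarrow> tensor_alg set ring" where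
  "cliff q = T_alg Quot cliff_ideal q"

definition cliff_class :: "(int^3 \<Rightarrow> int) \<Rightarrow> tensor_alg \<Rightarrow> tensor_alg set" where
  "cliff_class q f = cliff_ideal q +>\<^bsub>T_alg\<^esub> f"

definition cliff_vec :: "(int^3 \<Rightarrow> int) \<Rightarrow> int^3 \<Rightarrow> tensor_alg set" where
  "cliff_vec q x = cliff_class q (vec_T x)"

definition cliff_even :: "(int^3 \<Rightarrow> int) \<Rightarrow> tensor_alg set ring" where
  "cliff_even q = (cliff q)\<lparr>carrier := {cliff_class q f |f. \<forall>w\<in>Poly_Mapping.keys f. even (length w)}\<rparr>"

text \<open>
  The antiautomorphism of \<open>C(E)\<close> induced by \<^const>\<open>conj_T\<close>; see \<open>cliff_conj_class\<close> below.
\<close>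

definition cliff_conj :: "(int^3 \<Rightarrow> int) \<Rightarrow> tensor_alg set \<Rightarrow> tensor_alg set" where
  "cliff_conj q S = conj_T ` S"

definition special_elt :: "(int^3 \<Rightarrow> int) \<Rightarrow> tensor_alg set" where
  "special_elt q =
     (let e123 = cliff_vec q (axis 1 1) \<otimes>\<^bsub>cliff q\<^esub> cliff_vec q (axis 2 1) \<otimes>\<^bsub>cliff q\<^esub> cliff_vec q (axis 3 1)
      in e123 \<oplus>\<^bsub>cliff q\<^esub> cliff_conj q e123)"

text \<open>
  For every isometry \<open>\<alpha>\<close> there is exactly one such \<open>\<psi>\<close> on the carrier of \<open>C(E'')\<close>; its values elsewhere
  are irrelevant.
\<close>

definition is_lift ::
  "(int^3 \<Rightarrow> int) \<Rightarrow> (int^3 \<Rightarrow> int) \<Rightarrow> (int^3 \<Rightarrow> int^3) \<Rightarrow> (tensor_alg set \<Rightarrow> tensor_alg set) \<Rightarrow> bool"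
  where
  "is_lift q'' q \<alpha> \<psi> \<longleftrightarrow>
     \<psi> \<in> ring_hom (cliff q'') (cliff q) \<and> (\<forall>x. \<psi> (cliff_vec q'' x) = cliff_vec q (\<alpha> x))"

definition restricts_lift ::
  "(int^3 \<Rightarrow> int) \<Rightarrow> (int^3 \<Rightarrow> int) \<Rightarrow> (tensor_alg set \<Rightarrow> tensor_alg set) \<Rightarrow> (int^3 \<Rightarrow> int^3) \<Rightarrow> bool"
  where
  "restricts_lift q'' q \<phi> \<alpha> \<longleftrightarrow>
     (\<exists>\<psi>. is_lift q'' q \<alpha> \<psi> \<and> (\<forall>c\<in>carrier (cliff_even q''). \<phi> c = \<psi> c))"


section \<open>Extension of scalars\<close>

text \<open>
  The abelian group \<open>A \<otimes>\<^sub>\<int> \<complex>\<close> is the free abelian group on \<open>A \<times> \<complex>\<close> modulo biadditivity. The complex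
  multiple \<open>z \<cdot> (a \<otimes> 1)\<close> is the pure tensor \<open>a \<otimes> z\<close>.
\<close>

definition free_pairs :: "('a, 'm) ring_scheme \<Rightarrow> (('a \<times> complex) \<Rightarrow>\<^sub>0 int) monoid" where
  "free_pairs A = free_Abelian_group (carrier A \<times> UNIV)"

definition tensor_relations :: "('a, 'm) ring_scheme \<Rightarrow> (('a \<times> complex) \<Rightarrow>\<^sub>0 int) set" where
  "tensor_relations A = generate (free_pairs A)
     ({frag_of (a \<oplus>\<^bsub>A\<^esub> b, z) - frag_of (a, z) - frag_of (b, z) |a b z.
         a \<in> carrier A \<and> b \<in> carrier A} \<union>
      {frag_of (a, z + w) - frag_of (a, z) - frag_of (a, w) |a z w. a \<in> carrier A})"

definition tensor :: "('a, 'm) ring_scheme \<Rightarrow> 'a \<Rightarrow> complex \<Rightarrow> (('a \<times> complex) \<Rightarrow>\<^sub>0 int) set" where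
  "tensor A a z = tensor_relations A #>\<^bsub>free_pairs A\<^esub> frag_of (a, z)"


section \<open>Well-definedness\<close>

lemma T_alg_simps [simp]:
  "carrier T_alg = UNIV" "x \<otimes>\<^bsub>T_alg\<^esub> y = x * y" "x \<oplus>\<^bsub>T_alg\<^esub> y = x + y"
  "\<one>\<^bsub>T_alg\<^esub> = 1" "\<zero>\<^bsub>T_alg\<^esub> = 0"
  by (simp_all add: T_alg_def)

lemma ring_T_alg: "ring T_alg"
proof -
  have "\<exists>y. x + y = 0" for x :: tensor_alg
    using add.right_inverse by blast
  then show ?thesis
    by unfold_locales
       (auto simp: algebra_simps Units_def T_alg_def)
qed

lemma ideal_cliff_ideal: "ideal (cliff_ideal q) T_alg"
  unfolding cliff_ideal_def by (rule ring.genideal_ideal[OF ring_T_alg]) simp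

lemma ring_cliff: "ring (cliff q)"
  unfolding cliff_def by (rule ideal.quotient_is_ring[OF ideal_cliff_ideal])

lemma cliff_class_alt: "cliff_class q f = {h + f |h. h \<in> cliff_ideal q}"
  by (auto simp: cliff_class_def a_r_coset_def r_coset_def T_alg_def)

lemma cliff_class_hom: "cliff_class q \<in> ring_hom T_alg (cliff q)"
  using ideal.rcos_ring_hom[OF ideal_cliff_ideal, of q]
  by (simp add: cliff_def cliff_class_def[abs_def])

lemma cliff_class_mult: "cliff_class q f \<otimes>\<^bsub>cliff q\<^esub> cliff_class q g = cliff_class q (f * g)"
  using ring_hom_mult[OF cliff_class_hom, of f g] by simp

lemma cliff_class_add: "cliff_class q f \<oplus>\<^bsub>cliff q\<^esub> cliff_class q g = cliff_class q (f + g)"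
  using ring_hom_add[OF cliff_class_hom, of f g] by simp

lemma cliff_class_eqI: "f - g \<in> cliff_ideal q \<Longrightarrow> cliff_class q f = cliff_class q g"
proof -
  interpret ideal "cliff_ideal q" T_alg by (rule ideal_cliff_ideal)
  assume d: "f - g \<in> cliff_ideal q"
  have "f \<in> cliff_class q g"
    unfolding cliff_class_alt using d by (metis (mono_tags, lifting) diff_add_cancel mem_Collect_eq)
  then show ?thesis
    using a_repr_independence'[of f g] by (simp add: cliff_class_def)
qed

lemma cliff_relation: "vec_T x * vec_T x - of_int (q x) \<in> cliff_ideal q"
  unfolding cliff_ideal_def
  by (rule subsetD[OF ring.genideal_self[OF ring_T_alg]]) auto

lemma cliff_vec_square:
  "cliff_vec q x \<otimes>\<^bsub>cliff q\<^esub> cliff_vec q x = cliff_class q (of_int (q x))"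
  by (simp add: cliff_vec_def cliff_class_mult cliff_class_eqI cliff_relation)

lemma subring_cliff_even: "subring (carrier (cliff_even q)) (cliff q)"
proof -
  interpret ring "cliff q" by (rule ring_cliff)
  interpret h: ring_hom_ring T_alg "cliff q" "cliff_class q"
    by (rule ring_hom_ringI2[OF ring_T_alg ring_cliff cliff_class_hom])
  have minus: "\<ominus>\<^bsub>cliff q\<^esub> cliff_class q f = cliff_class q (- f)" for f
  proof -
    have "cliff_class q (- f) \<oplus>\<^bsub>cliff q\<^esub> cliff_class q f = \<zero>\<^bsub>cliff q\<^esub>"
      using h.hom_zero by (simp add: cliff_class_add)
    moreover have "cliff_class q g \<in> carrier (cliff q)" for g
      using h.hom_closed by simp
    ultimately show ?thesis
      using minus_equality by blast
  qed
  show ?thesis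
  proof (rule subringI)
    show "carrier (cliff_even q) \<subseteq> carrier (cliff q)"
      using h.hom_closed by (auto simp: cliff_even_def)
    have "\<one>\<^bsub>cliff q\<^esub> = cliff_class q 1"
      using h.hom_one by simp
    moreover have "\<forall>w\<in>Poly_Mapping.keys (1 :: tensor_alg). even (length w)"
      by (simp add: zero_list_def)
    ultimately show "\<one>\<^bsub>cliff q\<^esub> \<in> carrier (cliff_even q)"
      by (auto simp: cliff_even_def)
  next
    fix a assume "a \<in> carrier (cliff_even q)"
    then show "\<ominus>\<^bsub>cliff q\<^esub> a \<in> carrier (cliff_even q)"
      by (force simp: cliff_even_def minus)
  next
    fix a b assume "a \<in> carrier (cliff_even q)" "b \<in> carrier (cliff_even q)"
    then obtain f g where fg: "a = cliff_class q f" "b = cliff_class q g"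
      "\<forall>w\<in>Poly_Mapping.keys f. even (length w)" "\<forall>w\<in>Poly_Mapping.keys g. even (length w)"
      by (auto simp: cliff_even_def)
    have "\<forall>w\<in>Poly_Mapping.keys (f * g). even (length w)"
      using keys_mult[of f g] fg by (fastforce simp: plus_list_def)
    moreover have "\<forall>w\<in>Poly_Mapping.keys (f + g). even (length w)"
      using Poly_Mapping.keys_add[of f g] fg by blast
    ultimately show "a \<otimes>\<^bsub>cliff q\<^esub> b \<in> carrier (cliff_even q)"
      "a \<oplus>\<^bsub>cliff q\<^esub> b \<in> carrier (cliff_even q)"
      unfolding fg cliff_class_mult cliff_class_add by (auto simp: cliff_even_def)
  qed
qed

lemma conj_T_single: "conj_T (Poly_Mapping.single w c) = Poly_Mapping.single (rev w) ((- 1) ^ length w * c)"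
  by (cases "c = 0") (simp_all add: conj_T_def)

lemma conj_T_superset:
  assumes "finite W" "Poly_Mapping.keys f \<subseteq> W"
  shows "conj_T f = (\<Sum>w\<in>W. Poly_Mapping.single (rev w) ((- 1) ^ length w * Poly_Mapping.lookup f w))"
  unfolding conj_T_def
  by (rule sum.mono_neutral_left) (use assms in \<open>auto simp: in_keys_iff\<close>)

lemma conj_T_add: "conj_T (f + g) = conj_T f + conj_T g"
proof -
  have "Poly_Mapping.keys (f + g) \<subseteq> Poly_Mapping.keys f \<union> Poly_Mapping.keys g" by (rule Poly_Mapping.keys_add)
  then show ?thesis
    by (simp add: conj_T_superset[of "Poly_Mapping.keys f \<union> Poly_Mapping.keys g"] lookup_add sum.distrib
          ring_distribs Poly_Mapping.single_add)
qed

lemma conj_T_0 [simp]: "conj_T 0 = 0"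
  by (simp add: conj_T_def)

lemma conj_T_uminus: "conj_T (- f) = - conj_T f"
  using conj_T_add[of f "- f"] by (simp add: eq_neg_iff_add_eq_0 add.commute)

lemma conj_T_sum: "conj_T (sum g I) = (\<Sum>i\<in>I. conj_T (g i))"
  by (induction I rule: infinite_finite_induct) (simp_all add: conj_T_add)

lemma T_alg_expand: "f = (\<Sum>w\<in>Poly_Mapping.keys f. Poly_Mapping.single w (Poly_Mapping.lookup f w))" for f :: tensor_alg
  by (rule poly_mapping_eqI) (auto simp: lookup_sum lookup_single when_def in_keys_iff)

lemma conj_T_mult: "conj_T (f * g) = conj_T g * conj_T f"
proof -
  have single: "conj_T (Poly_Mapping.single v a * Poly_Mapping.single w b) =
      conj_T (Poly_Mapping.single w b) * conj_T (Poly_Mapping.single v a)" for v w a b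
    by (simp add: mult_single conj_T_single plus_list_def power_add ac_simps)
  show ?thesis
    apply (subst (1 2) T_alg_expand[of f])
    apply (subst (1 2) T_alg_expand[of g])
    apply (simp add: sum_product conj_T_sum single)
    apply (rule sum.swap)
    done
qed

lemma conj_T_conj_T [simp]: "conj_T (conj_T f) = f"
proof -
  have "conj_T (conj_T f) = (\<Sum>w\<in>Poly_Mapping.keys f. Poly_Mapping.single w (Poly_Mapping.lookup f w))"
    by (subst T_alg_expand[of f])
       (simp add: conj_T_sum conj_T_single mult.assoc[symmetric] power_add[symmetric])
  then show ?thesis by (simp add: T_alg_expand[symmetric])
qed

lemma conj_T_vec: "conj_T (vec_T x) = - vec_T x"
  by (simp add: vec_T_def conj_T_sum conj_T_single sum_negf single_uminus)

lemma conj_T_of_int: "conj_T (of_int k) = of_int k"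
proof -
  have 1: "conj_T 1 = 1"
    using conj_T_single[of 0 1] single_one[where ?'a = "3 list" and ?'b = int]
    by (simp add: zero_list_def)
  have nat: "conj_T (of_nat n) = of_nat n" for n
    by (induction n) (simp_all add: conj_T_add 1)
  have "conj_T (of_int (- int n)) = of_int (- int n)" for n
    by (simp add: nat conj_T_uminus)
  with nat show ?thesis
    by (cases k rule: int_cases2) (metis of_int_of_nat_eq)+
qed

lemma conj_T_cliff_ideal: "f \<in> cliff_ideal q \<Longrightarrow> conj_T f \<in> cliff_ideal q"
proof -
  interpret I: ideal "cliff_ideal q" T_alg by (rule ideal_cliff_ideal)
  have 0: "0 \<in> cliff_ideal q"
    using additive_subgroup.zero_closed[OF I.additive_subgroup_axioms] by simp
  have add: "a + b \<in> cliff_ideal q" if "a \<in> cliff_ideal q" "b \<in> cliff_ideal q" for a b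
    using additive_subgroup.a_closed[OF I.additive_subgroup_axioms that] by simp
  have mult: "a * b \<in> cliff_ideal q" "b * a \<in> cliff_ideal q" if "a \<in> cliff_ideal q" for a b
    using I.I_r_closed[OF that, of b] I.I_l_closed[OF that, of b] by simp_all
  have minus: "- a \<in> cliff_ideal q" if "a \<in> cliff_ideal q" for a
    using mult(1)[OF that, of "- 1"] by simp
  have "ideal {f. conj_T f \<in> cliff_ideal q} T_alg"
  proof (rule idealI[OF ring_T_alg])
    have inv: "inv\<^bsub>add_monoid T_alg\<^esub> a = - a" for a
      using I.minus_equality[of "- a" a] by (simp add: a_inv_def)
    show "subgroup {f. conj_T f \<in> cliff_ideal q} (add_monoid T_alg)"
      by (rule subgroup.intro) (auto simp: conj_T_add add inv[simplified] conj_T_uminus minus 0)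
  qed (simp_all add: conj_T_mult mult)
  moreover have "conj_T (vec_T x * vec_T x - of_int (q x)) \<in> cliff_ideal q" for x
  proof -
    have "conj_T (vec_T x * vec_T x - of_int (q x)) = vec_T x * vec_T x - of_int (q x)"
      using conj_T_add[of "vec_T x * vec_T x" "- of_int (q x)"]
      by (simp add: conj_T_mult conj_T_vec conj_T_of_int conj_T_uminus)
    then show ?thesis
      by (simp add: cliff_relation)
  qed
  ultimately have "cliff_ideal q \<subseteq> {f. conj_T f \<in> cliff_ideal q}"
    by (subst cliff_ideal_def, intro ring.genideal_minimal[OF ring_T_alg]) (auto simp: cliff_ideal_def)
  then show "f \<in> cliff_ideal q \<Longrightarrow> conj_T f \<in> cliff_ideal q"
    by blast
qed

lemma cliff_conj_class: "cliff_conj q (cliff_class q f) = cliff_class q (conj_T f)"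
proof -
  have "conj_T ` cliff_ideal q = cliff_ideal q"
    using conj_T_cliff_ideal by (force intro: image_eqI[where x = "conj_T _"])
  then show ?thesis
    unfolding cliff_conj_def cliff_class_alt
    by (auto simp: image_def conj_T_add conj_T_cliff_ideal intro: conj_T_cliff_ideal)
       (metis conj_T_add conj_T_cliff_ideal conj_T_conj_T)
qed

lemma special_elt_alt:
  "special_elt q = cliff_class q (Poly_Mapping.single [1, 2, 3] 1 - Poly_Mapping.single [3, 2, 1] 1)"
proof -
  have v: "vec_T (axis i 1) = Poly_Mapping.single [i] 1" for i
  proof -
    have "vec_T (axis i 1) = (\<Sum>j\<in>UNIV. if j = i then Poly_Mapping.single [i] 1 else 0)"
      unfolding vec_T_def by (rule sum.cong) (auto simp: axis_def)
    then show ?thesis by simp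
  qed
  show ?thesis
    by (simp add: special_elt_def cliff_vec_def cliff_class_mult cliff_conj_class cliff_class_add v
          mult_single conj_T_single plus_list_def single_uminus)
qed

end

theory Submission
  imports Defs
begin

text \<open>
  Left multiplication on the basis of ordered monomials identifies \<open>C(E)\<close> with \<open>\<int>\<^sup>8\<close>, so that \<open>C(E)\<close> is torsion free
  and pure tensors can be compared through their complex coordinates.

  If \<open>\<phi>\<close> comes from an isometry \<open>\<alpha>\<close> of determinant \<open>D\<close>, then its lift sends \<open>t''\<close> to \<open>D t\<close>, because
  \<open>xyz - zyx\<close> is an alternating trilinear function. Hence \<open>D\<^sup>2 \<Delta> = \<Delta>''\<close> and \<open>\<phi>(x t'') = D \<alpha>(x) t\<close>.

  Conversely, \<open>\<phi>(x t'') = r y t\<close> with \<open>r\<^sup>2 = \<Delta>'' / \<Delta>\<close> determines a linear map \<open>\<alpha>(x) = y\<close>, which is an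
  isometry since \<open>(x t'')\<^sup>2 = - q''(x) \<Delta>''\<close>. Its determinant is \<open>\<plusminus>r\<close>, so \<open>\<phi>\<close> agrees with the lift of
  \<open>\<alpha>\<close> up to a common sign on all \<open>x t''\<close>; the sign disappears in the products
  \<open>(x t'')(y t'') = - \<Delta>'' x y\<close>, which determine \<open>\<phi>\<close> because the target is torsion free.
\<close>


section \<open>A faithful integral model of the Clifford algebra\<close>

text \<open>The scalar action \<open>s\<close> is a parameter because two targets are needed: Z^8
  with \<open>oct_scale\<close>, and the complex numbers with integer multiples.\<close>

definition lin_ext :: "(int \<Rightarrow> 'b \<Rightarrow> 'b) \<Rightarrow> ('a \<Rightarrow> 'b) \<Rightarrow> ('a \<Rightarrow>\<^sub>0 int) \<Rightarrow> 'b::ab_group_add" where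
  "lin_ext s h f = (\<Sum>w\<in>Poly_Mapping.keys f. s (Poly_Mapping.lookup f w) (h w))"

context
  fixes s :: "int \<Rightarrow> 'b \<Rightarrow> 'b::ab_group_add"
  assumes module: "Modules.module s"
begin

interpretation Modules.module s by (rule module)

lemma lin_ext_superset:
  assumes "finite W" "Poly_Mapping.keys f \<subseteq> W"
  shows "lin_ext s h f = (\<Sum>w\<in>W. s (Poly_Mapping.lookup f w) (h w))"
  unfolding lin_ext_def
  by (rule sum.mono_neutral_left) (use assms in \<open>auto simp: in_keys_iff\<close>)

lemma lin_ext_0 [simp]: "lin_ext s h 0 = 0"
  by (simp add: lin_ext_def)

lemma lin_ext_add: "lin_ext s h (f + g) = lin_ext s h f + lin_ext s h g"
proof -
  have "Poly_Mapping.keys (f + g) \<subseteq> Poly_Mapping.keys f \<union> Poly_Mapping.keys g"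
    by (rule Poly_Mapping.keys_add)
  then show ?thesis
    by (simp add: lin_ext_superset[of "Poly_Mapping.keys f \<union> Poly_Mapping.keys g"] lookup_add
        sum.distrib scale_left_distrib)
qed

lemma lin_ext_diff: "lin_ext s h (f - g) = lin_ext s h f - lin_ext s h g"
  using lin_ext_add[of h "f - g" g] by simp

lemma lin_ext_uminus: "lin_ext s h (- f) = - lin_ext s h f"
  using lin_ext_diff[of h 0 f] by simp

lemma lin_ext_frag_of [simp]: "lin_ext s h (frag_of w) = h w"
  by (simp add: lin_ext_def)

end

text \<open>Words generate the additive group, and closure under subtraction already yields
  negatives and sums, so no case for scalar multiples arises.\<close>

lemma tensor_alg_induct:
  fixes f :: "'a \<Rightarrow>\<^sub>0 int"
  assumes "P 0" and "\<And>w. P (frag_of w)" and "\<And>f g. P f \<Longrightarrow> P g \<Longrightarrow> P (f - g)"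
  shows "P f"
  by (rule frag_induction[of f UNIV, OF subset_UNIV]) (rule assms; assumption?)+

lemma ideal_T_algI:
  assumes "0 \<in> I" and "\<And>g h. g \<in> I \<Longrightarrow> h \<in> I \<Longrightarrow> g + h \<in> I"
    and "\<And>g h. g \<in> I \<Longrightarrow> h * g \<in> I" and "\<And>g h. g \<in> I \<Longrightarrow> g * h \<in> I"
  shows "ideal I T_alg"
proof (rule idealI[OF ring_T_alg])
  have inv: "inv\<^bsub>add_monoid T_alg\<^esub> g = - g" for g
    using abelian_group.minus_equality[OF ring.is_abelian_group[OF ring_T_alg], of "- g" g]
    by (simp add: a_inv_def)
  have "- g \<in> I" if "g \<in> I" for g
    using assms(3)[OF that, of "- 1"] by simp
  then show "subgroup I (add_monoid T_alg)"
    using assms(1,2) by (intro subgroup.intro) (auto simp: inv[simplified])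
qed (use assms(3,4) in auto)

lemma cliff_ideal_add: "g \<in> cliff_ideal q \<Longrightarrow> h \<in> cliff_ideal q \<Longrightarrow> g + h \<in> cliff_ideal q"
  using additive_subgroup.a_closed[OF ideal.axioms(1)[OF ideal_cliff_ideal], of g q h] by simp

lemma cliff_ideal_mult_left: "g \<in> cliff_ideal q \<Longrightarrow> h * g \<in> cliff_ideal q"
  using ideal.I_l_closed[OF ideal_cliff_ideal, of g q h] by simp

lemma cliff_ideal_mult_right: "g \<in> cliff_ideal q \<Longrightarrow> g * h \<in> cliff_ideal q"
  using ideal.I_r_closed[OF ideal_cliff_ideal, of g q h] by simp

lemma cliff_ideal_0: "0 \<in> cliff_ideal q"
  using cliff_ideal_mult_left[OF cliff_relation[of undefined q], where h = 0] by simp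

lemma cliff_ideal_uminus: "g \<in> cliff_ideal q \<Longrightarrow> - g \<in> cliff_ideal q"
  using cliff_ideal_mult_left[of g q "- 1"] by simp

lemma cliff_ideal_diff: "g \<in> cliff_ideal q \<Longrightarrow> h \<in> cliff_ideal q \<Longrightarrow> g - h \<in> cliff_ideal q"
  using cliff_ideal_add[of g q "- h"] by (simp add: cliff_ideal_uminus)

section \<open>The regular representation on Z^8\<close>

text \<open>
  Coordinates with respect to the basis
  \<open>1, e\<^sub>1, e\<^sub>2, e\<^sub>3, e\<^sub>1e\<^sub>2, e\<^sub>1e\<^sub>3, e\<^sub>2e\<^sub>3, e\<^sub>1e\<^sub>2e\<^sub>3\<close> of the Clifford algebra.
\<close>

type_synonym oct = "int \<times> int \<times> int \<times> int \<times> int \<times> int \<times> int \<times> int"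

fun oct_scale :: "int \<Rightarrow> oct \<Rightarrow> oct" where
  "oct_scale k (u0, u1, u2, u3, u12, u13, u23, u123) =
     (k * u0, k * u1, k * u2, k * u3, k * u12, k * u13, k * u23, k * u123)"

lemma module_oct_scale: "Modules.module oct_scale"
  by (rule Modules.module.intro) (simp_all only: split_paired_all oct_scale.simps add_Pair, simp_all add: ring_distribs)

abbreviation gen :: "3 \<Rightarrow> tensor_alg" where "gen i \<equiv> frag_of [i]"

lemma single_eq_of_int: "Poly_Mapping.single w k = of_int k * (frag_of w :: tensor_alg)"
proof -
  have "of_int k = (Poly_Mapping.single 0 k :: tensor_alg)"
    by (metis of_int_eq_id id_apply single_of_int)
  then show ?thesis by (simp add: mult_single)
qed

lemma vec_T_eq: "vec_T x = of_int (x $ 1) * gen 1 + of_int (x $ 2) * gen 2 + of_int (x $ 3) * gen 3"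
  by (simp add: vec_T_def sum_3 single_eq_of_int[of _ "x $ i" for i])

lemma frag_of_Nil: "frag_of [] = (1 :: tensor_alg)"
  by (simp add: flip: zero_list_def)

lemma frag_of_Cons: "frag_of (i # w) = gen i * frag_of w"
  by (simp add: mult_single plus_list_def)

lemma frag_of_append: "frag_of (v @ w) = (frag_of v * frag_of w :: tensor_alg)"
  by (simp add: mult_single plus_list_def)

text \<open>Each mixed coefficient is named after the missing variable. In the Clifford algebra
  \<open>f\<close>, \<open>e\<close>, \<open>d\<close> are the anticommutators of the pairs e1 e2,
  e1 e3, e2 e3.\<close>

locale ternary_form =
  fixes q :: "int^3 \<Rightarrow> int" and a b c d e f :: int
  assumes q_eq: "q x = a * (x$1 * x$1) + b * (x$2 * x$2) + c * (x$3 * x$3)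
    + d * (x$2 * x$3) + e * (x$1 * x$3) + f * (x$1 * x$2)"
begin

text \<open>Left multiplication by \<open>e\<^sub>1\<close>, \<open>e\<^sub>2\<close>, \<open>e\<^sub>3\<close>.\<close>

fun L1 :: "oct \<Rightarrow> oct" where
  "L1 (u0, u1, u2, u3, u12, u13, u23, u123) =
     (a * u1, u0, a * u12, a * u13, u2, u3, a * u123, u23)"

fun L2 :: "oct \<Rightarrow> oct" where
  "L2 (u0, u1, u2, u3, u12, u13, u23, u123) =
     (f * u1 + b * u2, - b * u12, u0 + f * u12, f * u13 + b * u23,
      - u1, - b * u123, u3 + f * u123, - u13)"

fun L3 :: "oct \<Rightarrow> oct" where
  "L3 (u0, u1, u2, u3, u12, u13, u23, u123) =
     (e * u1 + d * u2 + c * u3, - d * u12 - c * u13, e * u12 - c * u23, u0 + e * u13 + d * u23,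
      c * u123, - u1 - d * u123, - u2 + e * u123, u12)"

definition L :: "3 \<Rightarrow> oct \<Rightarrow> oct" where
  "L i = (if i = 1 then L1 else if i = 2 then L2 else L3)"

lemma L_diff: "L i (u - v) = L i u - L i v"
  by (cases u rule: L1.cases; cases v rule: L1.cases) (simp add: L_def algebra_simps)

text \<open>The use of \<open>foldr\<close> lets the rightmost letter act first, which makes this a
  left module structure.\<close>

definition act :: "tensor_alg \<Rightarrow> oct \<Rightarrow> oct" where
  "act g v = lin_ext oct_scale (\<lambda>w. foldr L w v) g"

lemmas act_linear =
  lin_ext_diff[OF module_oct_scale, where h = "\<lambda>w. foldr L w v" for v, folded act_def]
  lin_ext_add[OF module_oct_scale, where h = "\<lambda>w. foldr L w v" for v, folded act_def]
  lin_ext_0[OF module_oct_scale, where h = "\<lambda>w. foldr L w v" for v, folded act_def]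
  lin_ext_uminus[OF module_oct_scale, where h = "\<lambda>w. foldr L w v" for v, folded act_def]

lemma act_frag_of: "act (frag_of w) v = foldr L w v"
  by (simp add: act_def lin_ext_frag_of[OF module_oct_scale])

lemma act_vec_diff: "act g (u - v) = act g u - act g v"
proof (induction g rule: tensor_alg_induct)
  case (2 w)
  show ?case unfolding act_frag_of by (induction w) (simp_all add: L_diff)
qed (simp_all add: act_linear)

lemma act_vec_0: "act g 0 = 0"
  using act_vec_diff[of g 0 0] by simp

lemma act_mult: "act (g * h) v = act g (act h v)"
proof (induction g arbitrary: h v rule: tensor_alg_induct)
  case (2 w)
  show ?case
    by (induction h rule: tensor_alg_induct)
       (simp_all add: act_linear act_vec_diff act_vec_0 right_diff_distrib act_frag_of flip: frag_of_append)
qed (simp_all add: act_linear left_diff_distrib)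

lemma act_1: "act 1 v = v"
  using act_frag_of[of "[]" v] by (simp add: frag_of_Nil)

lemma act_of_int: "act (of_int k) v = oct_scale k v"
proof -
  interpret Modules.module oct_scale by (rule module_oct_scale)
  show ?thesis
  proof (induction k rule: int_induct[where k = 0])
    case base
    then show ?case by (simp add: act_linear)
  next
    case (step1 i)
    then show ?case by (simp only: of_int_add of_int_1 act_linear act_1 scale_left_distrib scale_one)
  next
    case (step2 i)
    then show ?case by (simp only: of_int_diff of_int_1 act_linear act_1 scale_left_diff_distrib scale_one)
  qed
qed

lemma act_gen: "act (gen i) v = L i v"
  by (simp add: act_frag_of)

lemma act_vec_T:
  "act (vec_T x) v = oct_scale (x $ 1) (L1 v) + oct_scale (x $ 2) (L2 v) + oct_scale (x $ 3) (L3 v)"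
  by (simp add: vec_T_eq act_linear act_mult act_of_int act_gen L_def)

text \<open>This polynomial identity certifies the tables \<open>L1\<close>, \<open>L2\<close>,
  \<open>L3\<close>: on a generic vector of Z^8 each x acts with square q(x), so the action factors
  through C(E).\<close>

lemma act_cliff_relation: "act (vec_T x * vec_T x - of_int (q x)) v = 0"
  by (cases v rule: L1.cases)
     (simp add: act_linear act_mult act_vec_T act_of_int q_eq algebra_simps zero_prod_def)

text \<open>The elements that act as zero form a two-sided ideal containing the defining relations,
  hence the ideal they generate.\<close>

lemma act_cliff_ideal:
  assumes "g \<in> cliff_ideal q"
  shows "act g v = 0"
proof -
  have "ideal {g. \<forall>v. act g v = 0} T_alg"
    by (rule ideal_T_algI) (simp_all add: act_linear act_mult act_vec_0 del: split_paired_All)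
  then have "cliff_ideal q \<subseteq> {g. \<forall>v. act g v = 0}"
    unfolding cliff_ideal_def
    by (intro ring.genideal_minimal[OF ring_T_alg]) (auto simp: act_cliff_relation)
  then show ?thesis using assms by blast
qed


section \<open>Normal forms and coordinates of Clifford classes\<close>

fun sect :: "oct \<Rightarrow> tensor_alg" where
  "sect (u0, u1, u2, u3, u12, u13, u23, u123) =
     of_int u0 + of_int u1 * gen 1 + of_int u2 * gen 2 + of_int u3 * gen 3
     + of_int u12 * (gen 1 * gen 2) + of_int u13 * (gen 1 * gen 3) + of_int u23 * (gen 2 * gen 3)
     + of_int u123 * (gen 1 * gen 2 * gen 3)"

lemma sect_diff: "sect (u - v) = sect u - sect v"
  by (cases u rule: L1.cases; cases v rule: L1.cases) (simp add: algebra_simps)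

text \<open>Polarization: subtracting the relations at e_i and e_j from the one at e_i + e_j leaves
  the anticommutator.\<close>

lemma gen_relations:
  "gen 1 * gen 1 - of_int a \<in> cliff_ideal q" "gen 2 * gen 2 - of_int b \<in> cliff_ideal q"
  "gen 3 * gen 3 - of_int c \<in> cliff_ideal q"
  "gen 2 * gen 1 + gen 1 * gen 2 - of_int f \<in> cliff_ideal q"
  "gen 3 * gen 1 + gen 1 * gen 3 - of_int e \<in> cliff_ideal q"
  "gen 3 * gen 2 + gen 2 * gen 3 - of_int d \<in> cliff_ideal q"
proof -
  let ?r = "\<lambda>x. vec_T x * vec_T x - of_int (q x)"
  show sq: "gen 1 * gen 1 - of_int a \<in> cliff_ideal q" "gen 2 * gen 2 - of_int b \<in> cliff_ideal q"
    "gen 3 * gen 3 - of_int c \<in> cliff_ideal q"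
    using cliff_relation[of "axis 1 1" q] cliff_relation[of "axis 2 1" q] cliff_relation[of "axis 3 1" q]
    by (simp_all add: vec_T_eq q_eq axis_def)
  have "?r (axis 1 1 + axis 2 1) - (gen 1 * gen 1 - of_int a) - (gen 2 * gen 2 - of_int b) \<in> cliff_ideal q"
    by (intro cliff_ideal_diff cliff_relation sq)
  then show "gen 2 * gen 1 + gen 1 * gen 2 - of_int f \<in> cliff_ideal q"
    by (simp add: vec_T_eq q_eq axis_def algebra_simps)
  have "?r (axis 1 1 + axis 3 1) - (gen 1 * gen 1 - of_int a) - (gen 3 * gen 3 - of_int c) \<in> cliff_ideal q"
    by (intro cliff_ideal_diff cliff_relation sq)
  then show "gen 3 * gen 1 + gen 1 * gen 3 - of_int e \<in> cliff_ideal q"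
    by (simp add: vec_T_eq q_eq axis_def algebra_simps)
  have "?r (axis 2 1 + axis 3 1) - (gen 2 * gen 2 - of_int b) - (gen 3 * gen 3 - of_int c) \<in> cliff_ideal q"
    by (intro cliff_ideal_diff cliff_relation sq)
  then show "gen 3 * gen 2 + gen 2 * gen 3 - of_int d \<in> cliff_ideal q"
    by (simp add: vec_T_eq q_eq axis_def algebra_simps)
qed

text \<open>Integers are central. Moving them all to the front lets the simplifier compare
  noncommutative polynomials.\<close>

lemma of_int_normalize:
  "frag_of w * of_int k = of_int k * frag_of w"
  "frag_of w * (of_int k * h) = of_int k * (frag_of w * h)"
  "of_int j * (of_int k * h) = of_int (j * k) * h"
  for h :: tensor_alg and w :: "3 list"
  by (simp add: mult_of_int_commute)
     (metis mult.assoc mult_of_int_commute, simp add: mult.assoc)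

lemma gen_sect: "gen i * sect u - sect (L i u) \<in> cliff_ideal q"
proof (cases u rule: L1.cases)
  case (1 u0 u1 u2 u3 u12 u13 u23 u123)
  \<comment> \<open>The difference is an explicit combination of the defining relations.\<close>
  let ?r11 = "gen 1 * gen 1 - of_int a" and ?r22 = "gen 2 * gen 2 - of_int b"
  let ?r33 = "gen 3 * gen 3 - of_int c"
  let ?r21 = "gen 2 * gen 1 + gen 1 * gen 2 - of_int f"
  let ?r31 = "gen 3 * gen 1 + gen 1 * gen 3 - of_int e"
  let ?r32 = "gen 3 * gen 2 + gen 2 * gen 3 - of_int d"
  \<comment> \<open>The sums below carry factors 1 so that every term has the shape g * r * h with r
    a relation.\<close>
  have sandwich: "g * r * h \<in> cliff_ideal q" if "r \<in> cliff_ideal q" for g r h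
    using that by (intro cliff_ideal_mult_left cliff_ideal_mult_right)
  note I = gen_relations cliff_ideal_add cliff_ideal_diff sandwich
  consider "i = 1" | "i = 2" | "i = 3" using exhaust_3 by blast
  then show ?thesis
  proof cases
    case i: 1
    have "of_int u1 * ?r11 * 1 + of_int u12 * ?r11 * gen 2 + of_int u13 * ?r11 * gen 3
      + of_int u123 * ?r11 * (gen 2 * gen 3) \<in> cliff_ideal q"
      by (intro I)
    also have "of_int u1 * ?r11 * 1 + of_int u12 * ?r11 * gen 2 + of_int u13 * ?r11 * gen 3
      + of_int u123 * ?r11 * (gen 2 * gen 3)
      = gen i * sect u - sect (L i u)"
      by (simp add: 1 i L_def ring_distribs mult.assoc of_int_normalize mult.commute[of _ a]
          flip: of_int_mult)
    finally show ?thesis .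
  next
    case i: 2
    \<comment> \<open>Swapping e2 past e1 uses \<open>?r21\<close> and changes the sign; the square
      of e2 created behind e1 is then removed by \<open>?r22\<close>, hence the minus.\<close>
    have "of_int u1 * ?r21 * 1 + of_int u2 * ?r22 * 1
      + of_int u12 * ?r21 * gen 2 - of_int u12 * gen 1 * ?r22 * 1
      + of_int u13 * ?r21 * gen 3 + of_int u23 * ?r22 * gen 3
      + of_int u123 * ?r21 * (gen 2 * gen 3) - of_int u123 * gen 1 * ?r22 * gen 3 \<in> cliff_ideal q"
      by (intro I)
    also have "of_int u1 * ?r21 * 1 + of_int u2 * ?r22 * 1
      + of_int u12 * ?r21 * gen 2 - of_int u12 * gen 1 * ?r22 * 1
      + of_int u13 * ?r21 * gen 3 + of_int u23 * ?r22 * gen 3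
      + of_int u123 * ?r21 * (gen 2 * gen 3) - of_int u123 * gen 1 * ?r22 * gen 3
      = gen i * sect u - sect (L i u)"
      by (simp add: 1 i L_def ring_distribs mult.assoc of_int_normalize mult.commute[of _ f] mult.commute[of _ b]
          flip: of_int_mult)
    finally show ?thesis .
  next
    case i: 3
    \<comment> \<open>In the \<open>u123\<close> terms e3 passes both e1 and e2, so the two signs
      cancel and \<open>?r33\<close> enters with a plus.\<close>
    have "of_int u1 * ?r31 * 1 + of_int u2 * ?r32 * 1 + of_int u3 * ?r33 * 1
      + of_int u12 * ?r31 * gen 2 - of_int u12 * gen 1 * ?r32 * 1
      + of_int u13 * ?r31 * gen 3 - of_int u13 * gen 1 * ?r33 * 1
      + of_int u23 * ?r32 * gen 3 - of_int u23 * gen 2 * ?r33 * 1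
      + of_int u123 * ?r31 * (gen 2 * gen 3) - of_int u123 * gen 1 * ?r32 * gen 3
      + of_int u123 * (gen 1 * gen 2) * ?r33 * 1 \<in> cliff_ideal q"
      by (intro I)
    also have "of_int u1 * ?r31 * 1 + of_int u2 * ?r32 * 1 + of_int u3 * ?r33 * 1
      + of_int u12 * ?r31 * gen 2 - of_int u12 * gen 1 * ?r32 * 1
      + of_int u13 * ?r31 * gen 3 - of_int u13 * gen 1 * ?r33 * 1
      + of_int u23 * ?r32 * gen 3 - of_int u23 * gen 2 * ?r33 * 1
      + of_int u123 * ?r31 * (gen 2 * gen 3) - of_int u123 * gen 1 * ?r32 * gen 3
      + of_int u123 * (gen 1 * gen 2) * ?r33 * 1
      = gen i * sect u - sect (L i u)"
      by (simp add: 1 i L_def ring_distribs mult.assoc of_int_normalize mult.commute[of _ e] mult.commute[of _ d] mult.commute[of _ c]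
          flip: of_int_mult)
    finally show ?thesis .
  qed
qed

abbreviation oct_one :: oct where "oct_one \<equiv> (1, 0, 0, 0, 0, 0, 0, 0)"

text \<open>By induction on words, \<open>gen_sect\<close> straightens one letter at a time. Thus
  the eight ordered monomials span C(E), with coefficients read off from the action on 1;
  \<open>act_cliff_ideal\<close> makes these coefficients well defined.\<close>

lemma sect_act: "g - sect (act g oct_one) \<in> cliff_ideal q"
proof (induction g rule: tensor_alg_induct)
  case 1
  then show ?case by (simp add: act_linear zero_prod_def cliff_ideal_0)
next
  case (2 w)
  show ?case
  proof (induction w)
    case Nil
    then show ?case by (simp add: frag_of_Nil act_1 cliff_ideal_0)
  next
    case (Cons i w)
    let ?u = "act (frag_of w) oct_one"
    have "gen i * (frag_of w - sect ?u) + (gen i * sect ?u - sect (L i ?u)) \<in> cliff_ideal q"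
      by (intro cliff_ideal_add cliff_ideal_mult_left Cons gen_sect)
    then show ?case
      by (simp add: frag_of_Cons[of i w] act_mult act_gen right_diff_distrib)
  qed
next
  case (3 g h)
  then have "(g - sect (act g oct_one)) - (h - sect (act h oct_one)) \<in> cliff_ideal q"
    by (rule cliff_ideal_diff)
  then show ?case by (simp add: act_linear sect_diff algebra_simps)
qed

definition coord_T :: "tensor_alg \<Rightarrow> oct" where
  "coord_T g = act g oct_one"

lemma cliff_class_eq_iff: "cliff_class q g = cliff_class q h \<longleftrightarrow> coord_T g = coord_T h"
proof
  assume "cliff_class q g = cliff_class q h"
  moreover have "g \<in> cliff_class q g"
    unfolding cliff_class_alt using cliff_ideal_0 by force
  ultimately have "g \<in> cliff_class q h" by simp
  then have "g - h \<in> cliff_ideal q"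
    by (auto simp: cliff_class_alt)
  then show "coord_T g = coord_T h"
    using act_cliff_ideal[of "g - h" oct_one] by (simp add: coord_T_def act_linear)
next
  assume "coord_T g = coord_T h"
  then have "(g - sect (coord_T g)) - (h - sect (coord_T h)) = g - h" by simp
  then have "g - h \<in> cliff_ideal q"
    using cliff_ideal_diff[OF sect_act[of g] sect_act[of h]] by (simp add: coord_T_def)
  then show "cliff_class q g = cliff_class q h" by (rule cliff_class_eqI)
qed

text \<open>The product of C(E) transported to Z^8: the normal form of the left factor acts on the
  right factor.\<close>

fun oct_mult :: "oct \<Rightarrow> oct \<Rightarrow> oct" where
  "oct_mult (u0, u1, u2, u3, u12, u13, u23, u123) v =
     oct_scale u0 v + oct_scale u1 (L1 v) + oct_scale u2 (L2 v) + oct_scale u3 (L3 v)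
     + oct_scale u12 (L1 (L2 v)) + oct_scale u13 (L1 (L3 v)) + oct_scale u23 (L2 (L3 v))
     + oct_scale u123 (L1 (L2 (L3 v)))"

lemma act_sect: "act (sect u) v = oct_mult u v"
  by (cases u rule: L1.cases) (simp add: act_linear act_mult act_of_int act_gen L_def)

text \<open>The left factor may be replaced by its normal form, because their difference lies in the
  ideal and acts as zero.\<close>

lemma coord_T_mult: "coord_T (g * h) = oct_mult (coord_T g) (coord_T h)"
proof -
  have "act (g - sect (coord_T g)) (coord_T h) = 0"
    by (rule act_cliff_ideal) (simp add: coord_T_def sect_act)
  then have "act g (coord_T h) = oct_mult (coord_T g) (coord_T h)"
    by (simp only: act_linear act_sect right_minus_eq)
  then show ?thesis
    by (simp add: coord_T_def act_mult)
qed

lemma coord_T_linear [simp]: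
  "coord_T (g + h) = coord_T g + coord_T h" "coord_T (g - h) = coord_T g - coord_T h"
  "coord_T (- g) = - coord_T g" "coord_T 0 = 0"
  by (simp_all add: coord_T_def act_linear)

lemma coord_T_of_int: "coord_T (of_int k) = (k, 0, 0, 0, 0, 0, 0, 0)"
  by (simp add: coord_T_def act_of_int)

lemma coord_T_vec: "coord_T (vec_T x) = (0, x $ 1, x $ 2, x $ 3, 0, 0, 0, 0)"
  by (simp add: coord_T_def act_vec_T)

end

section \<open>The special element\<close>

lemma vec_T_add: "vec_T (x + y) = vec_T x + vec_T y"
  by (simp add: vec_T_eq ring_distribs)

lemma vec_T_scale: "vec_T (k *s x) = of_int k * vec_T x"
  by (simp add: vec_T_eq ring_distribs mult.assoc)

lemma vec_T_uminus: "vec_T (- x) = - vec_T x"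
  by (simp add: vec_T_eq)

lemma vec_T_axis: "vec_T (axis i 1) = gen i"
  using exhaust_3[of i] by (auto simp: vec_T_eq axis_def)

text \<open>A representative of t: the conjugate of e1 e2 e3 is - e3 e2 e1.\<close>

definition special_T :: tensor_alg where
  "special_T = gen 1 * gen 2 * gen 3 - gen 3 * gen 2 * gen 1"

lemma special_elt_eq: "special_elt q = cliff_class q special_T"
  by (simp add: special_elt_alt special_T_def mult_single plus_list_def)

definition det_3 :: "int^3 \<Rightarrow> int^3 \<Rightarrow> int^3 \<Rightarrow> int" where
  "det_3 x y z = x$1 * (y$2 * z$3 - y$3 * z$2) - x$2 * (y$1 * z$3 - y$3 * z$1)
     + x$3 * (y$1 * z$2 - y$2 * z$1)"

context ternary_form
begin

text \<open>Half the determinant of the symmetric matrix with diagonal 2a, 2b, 2c and off-diagonal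
  entries f, e, d.\<close>

definition delta :: int where
  "delta = 4 * (a * b * c) + d * e * f - a * (d * d) - b * (e * e) - c * (f * f)"

lemma coord_T_gen:
  "coord_T (gen 1) = (0, 1, 0, 0, 0, 0, 0, 0)" "coord_T (gen 2) = (0, 0, 1, 0, 0, 0, 0, 0)"
  "coord_T (gen 3) = (0, 0, 0, 1, 0, 0, 0, 0)"
  by (simp_all add: coord_T_def act_gen L_def)

lemma coord_T_special: "coord_T special_T = (0, - d, e, - f, 0, 0, 0, 2)"
  by (simp add: special_T_def coord_T_mult coord_T_gen)

lemma oct_mult_of_int: "oct_mult (k, 0, 0, 0, 0, 0, 0, 0) v = oct_scale k v"
  by (cases v rule: L1.cases) simp

lemma coord_T_of_int_mult: "coord_T (of_int k * g) = oct_scale k (coord_T g)"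
  by (simp only: coord_T_mult coord_T_of_int oct_mult_of_int)

lemma special_central: "cliff_class q (special_T * g) = cliff_class q (g * special_T)"
  unfolding cliff_class_eq_iff coord_T_mult coord_T_special
  by (cases "coord_T g" rule: L1.cases) (simp add: algebra_simps)

lemma special_square: "cliff_class q (special_T * special_T) = cliff_class q (of_int (- delta))"
  unfolding cliff_class_eq_iff coord_T_mult coord_T_special coord_T_of_int
  by (simp add: delta_def algebra_simps)

text \<open>The left side is trilinear and alternating in x, y, z, and its value at the standard
  basis is t. This determines where a lift sends the special element.\<close>

lemma triple_alternating:
  "cliff_class q (vec_T x * vec_T y * vec_T z - vec_T z * vec_T y * vec_T x)
     = cliff_class q (of_int (det_3 x y z) * special_T)"
  unfolding cliff_class_eq_iff coord_T_linear coord_T_mult coord_T_special coord_T_of_int coord_T_vec det_3_def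
  by (simp add: algebra_simps)

text \<open>Centrality of t turns the square into x^2 t^2 = q(x) (- \<Delta>).\<close>

lemma vec_special_square:
  "cliff_class q (vec_T x * special_T * (vec_T x * special_T)) = cliff_class q (of_int (- (q x * delta)))"
  unfolding cliff_class_eq_iff coord_T_mult coord_T_special coord_T_of_int coord_T_vec
  by (simp add: delta_def q_eq algebra_simps)

text \<open>Up to the factor - \<Delta>, products of two vectors are recovered from the elements x
  t. Since those products generate the even part, a homomorphism can be controlled through its
  values on x t.\<close>

lemma vec_special_mult:
  "cliff_class q (vec_T x * special_T * (vec_T y * special_T))
     = cliff_class q (of_int (- delta) * (vec_T x * vec_T y))"
proof -
  have "cliff_class q (vec_T x * special_T * (vec_T y * special_T))
    = cliff_class q (vec_T x) \<otimes>\<^bsub>cliff q\<^esub> cliff_class q (special_T * vec_T y) \<otimes>\<^bsub>cliff q\<^esub> cliff_class q special_T"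
    by (simp only: cliff_class_mult mult.assoc)
  also have "\<dots> = cliff_class q (vec_T x * vec_T y) \<otimes>\<^bsub>cliff q\<^esub> cliff_class q (special_T * special_T)"
    unfolding special_central[of "vec_T y"] by (simp only: cliff_class_mult mult.assoc)
  also have "\<dots> = cliff_class q (of_int (- delta) * (vec_T x * vec_T y))"
    unfolding special_square cliff_class_mult
    by (simp only: mult_of_int_commute[of "- delta" "vec_T x * vec_T y"])
  finally show ?thesis .
qed

lemma vec_special_special:
  "cliff_class q (vec_T x * special_T * special_T) = cliff_class q (of_int (- delta) * vec_T x)"
proof -
  have "cliff_class q (vec_T x * special_T * special_T)
    = cliff_class q (vec_T x) \<otimes>\<^bsub>cliff q\<^esub> cliff_class q (special_T * special_T)"
    by (simp only: cliff_class_mult mult.assoc)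
  then show ?thesis
    unfolding special_square cliff_class_mult by (simp only: mult_of_int_commute[of "- delta" "vec_T x"])
qed

text \<open>A further multiplication by t turns x t into - \<Delta> x, from which x can be read
  off.\<close>

lemma vec_special_inj:
  assumes "delta \<noteq> 0" and "coord_T (vec_T x * special_T) = coord_T (vec_T y * special_T)"
  shows "x = y"
proof -
  have "coord_T (vec_T x * special_T * special_T) = coord_T (vec_T y * special_T * special_T)"
    using assms(2) by (simp only: coord_T_mult)
  then have "coord_T (of_int (- delta) * vec_T x) = coord_T (of_int (- delta) * vec_T y)"
    using vec_special_special[of x] vec_special_special[of y] by (simp only: cliff_class_eq_iff)
  then show ?thesis
    using assms(1) unfolding coord_T_of_int_mult coord_T_vec by (simp add: vec_eq_iff forall_3)
qed

end

lemma gram_matrix_ternary_form: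
  assumes "gram_matrix q Q"
  obtains a b c d e f where "ternary_form q a b c d e f"
    and "det Q = 2 * ternary_form.delta a b c d e f"
proof -
  have sym: "Q $ 2 $ 1 = Q $ 1 $ 2" "Q $ 3 $ 1 = Q $ 1 $ 3" "Q $ 3 $ 2 = Q $ 2 $ 3"
    and eq: "2 * q x = (\<Sum>i\<in>UNIV. \<Sum>j\<in>UNIV. x $ i * Q $ i $ j * x $ j)" for x
    using assms by (auto simp: gram_matrix_def)
  \<comment> \<open>Evaluating the Gram identity at basis vectors shows that the diagonal entries of
    Q are 2 q(e_i), so their halves are integers.\<close>
  define a b c where "a = q (axis 1 1)" and "b = q (axis 2 1)" and "c = q (axis 3 1)"
  have diag: "Q $ 1 $ 1 = 2 * a" "Q $ 2 $ 2 = 2 * b" "Q $ 3 $ 3 = 2 * c"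
    using eq[of "axis 1 1"] eq[of "axis 2 1"] eq[of "axis 3 1"]
    by (simp_all add: a_def b_def c_def sum_3 axis_def)
  have form: "ternary_form q a b c (Q $ 2 $ 3) (Q $ 1 $ 3) (Q $ 1 $ 2)"
  proof
    fix x
    show "q x = a * (x$1 * x$1) + b * (x$2 * x$2) + c * (x$3 * x$3)
      + Q $ 2 $ 3 * (x$2 * x$3) + Q $ 1 $ 3 * (x$1 * x$3) + Q $ 1 $ 2 * (x$1 * x$2)"
      using eq[of x] by (simp add: sum_3 sym diag algebra_simps)
  qed
  moreover have "det Q = 2 * ternary_form.delta a b c (Q $ 2 $ 3) (Q $ 1 $ 3) (Q $ 1 $ 2)"
    unfolding ternary_form.delta_def[OF form] by (simp add: det_3 sym diag algebra_simps)
  ultimately show ?thesis by (rule that)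
qed

section \<open>Comparing pure tensors\<close>

definition tensor_generators :: "('a, 'm) ring_scheme \<Rightarrow> (('a \<times> complex) \<Rightarrow>\<^sub>0 int) set" where
  "tensor_generators A =
     {frag_of (a \<oplus>\<^bsub>A\<^esub> b, z) - frag_of (a, z) - frag_of (b, z) |a b z.
        a \<in> carrier A \<and> b \<in> carrier A} \<union>
     {frag_of (a, z + w) - frag_of (a, z) - frag_of (a, w) |a z w. a \<in> carrier A}"

lemma group_free_pairs: "group (free_pairs A)"
  by (simp add: free_pairs_def)

context
  fixes A :: "('a, 'm) ring_scheme"
  assumes ring: "ring A"
begin

lemma frag_of_in_free_pairs: "a \<in> carrier A \<Longrightarrow> frag_of (a, z) \<in> carrier (free_pairs A)"
  by (simp add: free_pairs_def)

lemma tensor_generators_carrier: "tensor_generators A \<subseteq> carrier (free_pairs A)"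
proof -
  interpret ring A by (rule ring)
  have diff: "x - y \<in> carrier (free_pairs A)"
    if "x \<in> carrier (free_pairs A)" "y \<in> carrier (free_pairs A)" for x y
    using that keys_diff[of x y] by (auto simp: free_pairs_def)
  show ?thesis
    unfolding tensor_generators_def by (auto intro!: diff frag_of_in_free_pairs)
qed

lemma subgroup_tensor_relations: "subgroup (tensor_relations A) (free_pairs A)"
  unfolding tensor_relations_def tensor_generators_def[symmetric]
  by (rule group.generate_is_subgroup[OF group_free_pairs tensor_generators_carrier])

lemma tensor_generators_subset: "tensor_generators A \<subseteq> tensor_relations A"
  unfolding tensor_relations_def tensor_generators_def[symmetric] by (auto intro: generate.incl)

lemma tensor_relations_0: "0 \<in> tensor_relations A"
  using subgroup.one_closed[OF subgroup_tensor_relations] by (simp add: free_pairs_def)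

lemma tensor_relations_add:
  "x \<in> tensor_relations A \<Longrightarrow> y \<in> tensor_relations A \<Longrightarrow> x + y \<in> tensor_relations A"
  using subgroup.m_closed[OF subgroup_tensor_relations, of x y] by (simp add: free_pairs_def)

lemma tensor_relations_uminus:
  assumes "x \<in> tensor_relations A"
  shows "- x \<in> tensor_relations A"
proof -
  have "Poly_Mapping.keys x \<subseteq> carrier A \<times> UNIV"
    using subgroup.mem_carrier[OF subgroup_tensor_relations assms] by (simp add: free_pairs_def)
  then show ?thesis
    using subgroup.m_inv_closed[OF subgroup_tensor_relations assms] by (simp add: free_pairs_def)
qed

lemma tensor_eq_iff:
  assumes "a \<in> carrier A" "b \<in> carrier A"
  shows "tensor A a z = tensor A b w \<longleftrightarrow> frag_of (a, z) - frag_of (b, w) \<in> tensor_relations A"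
proof
  assume "tensor A a z = tensor A b w"
  then have "frag_of (a, z) \<in> tensor_relations A #>\<^bsub>free_pairs A\<^esub> frag_of (b, w)"
    using group.rcos_self[OF group_free_pairs frag_of_in_free_pairs[OF assms(1), of z] subgroup_tensor_relations]
    by (simp add: tensor_def)
  then show "frag_of (a, z) - frag_of (b, w) \<in> tensor_relations A"
    by (auto simp: r_coset_def free_pairs_def)
next
  assume "frag_of (a, z) - frag_of (b, w) \<in> tensor_relations A"
  then have "frag_of (a, z) \<in> tensor_relations A #>\<^bsub>free_pairs A\<^esub> frag_of (b, w)"
    unfolding r_coset_def free_pairs_def by (force intro: bexI[where x = "frag_of (a, z) - frag_of (b, w)"])
  then show "tensor A a z = tensor A b w"
    using group.repr_independence[OF group_free_pairs _ frag_of_in_free_pairs[OF assms(2), of w] subgroup_tensor_relations]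
    by (simp add: tensor_def)
qed

lemma tensor_add_left:
  assumes "a \<in> carrier A" "b \<in> carrier A"
  shows "frag_of (a \<oplus>\<^bsub>A\<^esub> b, z) - frag_of (a, z) - frag_of (b, z) \<in> tensor_relations A"
  by (rule subsetD[OF tensor_generators_subset]) (use assms in \<open>unfold tensor_generators_def, blast\<close>)

lemma tensor_add_right:
  assumes "a \<in> carrier A"
  shows "frag_of (a, z + w) - frag_of (a, z) - frag_of (a, w) \<in> tensor_relations A"
  by (rule subsetD[OF tensor_generators_subset]) (use assms in \<open>unfold tensor_generators_def, blast\<close>)

text \<open>An additive map h into the complex numbers induces a well-defined additive map sending a
  \<otimes> z to h(a) z, so equal tensors have equal values.\<close>

lemma tensor_eqD:
  fixes h :: "'a \<Rightarrow> complex"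
  assumes h: "\<And>a b. a \<in> carrier A \<Longrightarrow> b \<in> carrier A \<Longrightarrow> h (a \<oplus>\<^bsub>A\<^esub> b) = h a + h b"
    and "a \<in> carrier A" "b \<in> carrier A" and "tensor A a z = tensor A b w"
  shows "h a * z = h b * w"
proof -
  \<comment> \<open>The map is first defined on the free group on pairs; both kinds of biadditivity
    relation are sent to 0.\<close>
  define F where "F = lin_ext (\<lambda>k z. of_int k * z) (\<lambda>(a, z). h a * z)"
  have module: "Modules.module (\<lambda>k z. of_int k * z :: complex)"
    by unfold_locales (simp_all add: ring_distribs)
  have F: "F (frag_of (a, z)) = h a * z" "F (x + y) = F x + F y" "F (x - y) = F x - F y" "F (- x) = - F x" "F 0 = 0"
    for a z x y
    by (simp_all add: F_def lin_ext_frag_of[OF module] lin_ext_add[OF module] lin_ext_diff[OF module]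
        lin_ext_uminus[OF module] lin_ext_0[OF module])
  have F_gen: "F x = 0" if "x \<in> tensor_generators A" for x
    using that unfolding tensor_generators_def by (auto simp: F h ring_distribs)
  have "F x = 0" if "x \<in> tensor_relations A" for x
  proof -
    have "x \<in> generate (free_pairs A) (tensor_generators A)"
      using that by (simp add: tensor_relations_def tensor_generators_def)
    then show ?thesis
    proof induction
      case one
      then show ?case by (simp add: free_pairs_def F)
    next
      case (incl x)
      then show ?case by (rule F_gen)
    next
      case (inv x)
      then have "Poly_Mapping.keys x \<subseteq> carrier A \<times> UNIV"
        using subsetD[OF tensor_generators_carrier inv] by (simp add: free_pairs_def)
      then show ?case using F_gen[OF inv] by (simp add: free_pairs_def F)
    next
      case (eng x y)
      then show ?case by (simp add: free_pairs_def F)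
    qed
  qed
  then have "F (frag_of (a, z) - frag_of (b, w)) = 0"
    using assms by (simp add: tensor_eq_iff)
  then show ?thesis by (simp add: F)
qed

end

lemma cliff_class_carrier: "cliff_class q g \<in> carrier (cliff q)"
  using ring_hom_closed[OF cliff_class_hom, of g q] by simp

lemma carrier_cliff: "c \<in> carrier (cliff q) \<Longrightarrow> \<exists>g. c = cliff_class q g"
  by (auto simp: cliff_def FactRing_def A_RCOSETS_def' cliff_class_def)

text \<open>The defect \<open>D n\<close> changes by a difference of two biadditivity relations when
  n grows by one, so induction in both directions from 0 reaches every integer.\<close>

lemma tensor_of_int:
  "tensor (cliff q) (cliff_class q (of_int n * g)) z = tensor (cliff q) (cliff_class q g) (of_int n * z)"
proof -
  define D where "D n = frag_of (cliff_class q (of_int n * g), z) - frag_of (cliff_class q g, of_int n * z)" for n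
  note rel = tensor_relations_0 tensor_relations_add tensor_relations_uminus tensor_add_left tensor_add_right
  note rel = rel[OF ring_cliff[of q]]
  have diff: "x - y \<in> tensor_relations (cliff q)"
    if "x \<in> tensor_relations (cliff q)" "y \<in> tensor_relations (cliff q)" for x y
    using rel(2)[OF that(1) rel(3)[OF that(2)]] by simp
  have step: "D (n + 1) - D n \<in> tensor_relations (cliff q)" for n
  proof -
    have "D (n + 1) - D n =
      (frag_of (cliff_class q (of_int n * g) \<oplus>\<^bsub>cliff q\<^esub> cliff_class q g, z)
        - frag_of (cliff_class q (of_int n * g), z) - frag_of (cliff_class q g, z))
      - (frag_of (cliff_class q g, of_int n * z + z) - frag_of (cliff_class q g, of_int n * z)
        - frag_of (cliff_class q g, z))"
      by (simp add: D_def cliff_class_add ring_distribs)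
    then show ?thesis
      using diff rel(4,5) cliff_class_carrier by metis
  qed
  have "D n \<in> tensor_relations (cliff q)"
  proof (induction n rule: int_induct[where k = 0])
    case base
    \<comment> \<open>Adding zero to itself in either slot shows that 0 \<otimes> z and g \<otimes>
      0 vanish.\<close>
    have "frag_of (cliff_class q 0 \<oplus>\<^bsub>cliff q\<^esub> cliff_class q 0, z) - frag_of (cliff_class q 0, z)
        - frag_of (cliff_class q 0, z) \<in> tensor_relations (cliff q)"
      "frag_of (cliff_class q g, 0 + 0) - frag_of (cliff_class q g, 0) - frag_of (cliff_class q g, 0)
        \<in> tensor_relations (cliff q)"
      by (intro rel cliff_class_carrier)+
    from diff[OF this(2,1)] show ?case
      by (simp add: D_def cliff_class_add)
  next
    case (step1 i)
    then show ?case using rel(2)[OF step1(2) step[of i]] by simp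
  next
    case (step2 i)
    then show ?case using diff[OF step2(2) step[of "i - 1"]] by simp
  qed
  then show ?thesis
    unfolding D_def by (simp add: tensor_eq_iff[OF ring_cliff] cliff_class_carrier)
qed


section \<open>Complex coordinates of pure tensors\<close>

fun oct_complex :: "complex \<Rightarrow> oct \<Rightarrow> complex \<times> complex \<times> complex \<times> complex \<times> complex \<times> complex \<times> complex \<times> complex"
  where "oct_complex z (u0, u1, u2, u3, u12, u13, u23, u123) =
    (of_int u0 * z, of_int u1 * z, of_int u2 * z, of_int u3 * z,
     of_int u12 * z, of_int u13 * z, of_int u23 * z, of_int u123 * z)"

lemma oct_complex_add: "oct_complex z (u + v) = oct_complex z u + oct_complex z v"
  by (cases "(z, u)" rule: oct_complex.cases; cases "(z, v)" rule: oct_complex.cases)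
     (simp add: ring_distribs)

lemma oct_complex_scale: "oct_complex z (oct_scale k u) = oct_complex (of_int k * z) u"
  by (cases "(z, u)" rule: oct_complex.cases) simp

lemma oct_complex_inj: "oct_complex z u = oct_complex z v \<Longrightarrow> z \<noteq> 0 \<Longrightarrow> u = v"
  by (cases "(z, u)" rule: oct_complex.cases; cases "(z, v)" rule: oct_complex.cases) simp

context ternary_form
begin

text \<open>The choice of representative is harmless, since by \<open>cliff_class_eq_iff\<close>
  coordinates are constant on a class.\<close>

definition coord :: "tensor_alg set \<Rightarrow> oct" where
  "coord S = coord_T (SOME g. S = cliff_class q g)"

lemma coord_class [simp]: "coord (cliff_class q g) = coord_T g"
proof -
  have "cliff_class q g = cliff_class q (SOME h. cliff_class q g = cliff_class q h)"
    by (rule someI) (rule refl)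
  then show ?thesis
    unfolding coord_def cliff_class_eq_iff by simp
qed

text \<open>Each of the eight coordinate projections is additive, so \<open>tensor_eqD\<close>
  applies to it.\<close>

lemma tensor_cliff_eqD:
  assumes "tensor (cliff q) (cliff_class q g) z = tensor (cliff q) (cliff_class q h) w"
  shows "oct_complex z (coord_T g) = oct_complex w (coord_T h)"
proof -
  have p: "of_int (p (coord_T g)) * z = of_int (p (coord_T h)) * w"
    if add: "\<And>u v. p (u + v) = p u + p v" for p :: "oct \<Rightarrow> int"
  proof -
    have "of_int (p (coord (cliff_class q g))) * z = of_int (p (coord (cliff_class q h))) * w"
    proof (rule tensor_eqD[OF ring_cliff _ _ _ assms, where h = "\<lambda>S. of_int (p (coord S))"])
      fix S S' assume "S \<in> carrier (cliff q)" "S' \<in> carrier (cliff q)"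
      then show "of_int (p (coord (S \<oplus>\<^bsub>cliff q\<^esub> S'))) = of_int (p (coord S)) + of_int (p (coord S'))"
        by (auto dest!: carrier_cliff simp: cliff_class_add add)
    qed (rule cliff_class_carrier)+
    then show ?thesis by simp
  qed
  show ?thesis
    using p[of fst] p[of "\<lambda>u. fst (snd u)"] p[of "\<lambda>u. fst (snd (snd u))"]
      p[of "\<lambda>u. fst (snd (snd (snd u)))"] p[of "\<lambda>u. fst (snd (snd (snd (snd u))))"]
      p[of "\<lambda>u. fst (snd (snd (snd (snd (snd u)))))"]
      p[of "\<lambda>u. fst (snd (snd (snd (snd (snd (snd u))))))"]
      p[of "\<lambda>u. snd (snd (snd (snd (snd (snd (snd u))))))"]
    by (cases "(z, coord_T g)" rule: oct_complex.cases; cases "(w, coord_T h)" rule: oct_complex.cases) simp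
qed

text \<open>The scalar coordinate of a square is homogeneous of degree two in the coordinates. This
  permits squaring even though r is complex and the product lives on Z^8.\<close>

lemma oct_complex_square:
  assumes "oct_complex 1 u = oct_complex r v"
  shows "of_int (fst (oct_mult u u)) = r\<^sup>2 * of_int (fst (oct_mult v v))"
proof (cases u rule: L1.cases; cases v rule: L1.cases)
  fix u0 u1 u2 u3 u12 u13 u23 u123 v0 v1 v2 v3 v12 v13 v23 v123 
  assume u: "u = (u0, u1, u2, u3, u12, u13, u23, u123)" and v: "v = (v0, v1, v2, v3, v12, v13, v23, v123)"
  have eqs: "complex_of_int u0 = of_int v0 * r" "complex_of_int u1 = of_int v1 * r"
    "complex_of_int u2 = of_int v2 * r" "complex_of_int u3 = of_int v3 * r"
    "complex_of_int u12 = of_int v12 * r" "complex_of_int u13 = of_int v13 * r"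
    "complex_of_int u23 = of_int v23 * r" "complex_of_int u123 = of_int v123 * r"
    using assms by (simp_all add: u v)
  show ?thesis
    by (simp add: u v eqs algebra_simps power2_eq_square)
qed

end

section \<open>Even elements\<close>

definition even_T :: "tensor_alg set" where
  "even_T = {g. \<forall>w\<in>Poly_Mapping.keys g. even (length w)}"

lemma carrier_cliff_even: "carrier (cliff_even q) = cliff_class q ` even_T"
  by (auto simp: cliff_even_def even_T_def)

lemma carrier_cliff_even_subset: "carrier (cliff_even q) \<subseteq> carrier (cliff q)"
  by (auto simp: carrier_cliff_even cliff_class_carrier)

lemma cliff_even_ops:
  "mult (cliff_even q) = mult (cliff q)" "add (cliff_even q) = add (cliff q)"
  "one (cliff_even q) = one (cliff q)"
  by (simp_all add: cliff_even_def)

lemma even_T_diff: "g \<in> even_T \<Longrightarrow> h \<in> even_T \<Longrightarrow> g - h \<in> even_T"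
  using keys_diff[of g h] by (fastforce simp: even_T_def)

lemma even_T_add: "g \<in> even_T \<Longrightarrow> h \<in> even_T \<Longrightarrow> g + h \<in> even_T"
  using Poly_Mapping.keys_add[of g h] by (fastforce simp: even_T_def)

lemma even_T_mult: "g \<in> even_T \<Longrightarrow> h \<in> even_T \<Longrightarrow> g * h \<in> even_T"
  using keys_mult[of g h] by (fastforce simp: even_T_def plus_list_def)

lemma even_T_frag_of: "frag_of w \<in> even_T \<longleftrightarrow> even (length w)"
  by (simp add: even_T_def)

lemma even_T_of_int: "of_int k \<in> even_T"
proof -
  have "0 \<in> even_T" "1 \<in> even_T"
    by (simp_all add: even_T_def zero_list_def)
  then show ?thesis
    by (induction k rule: int_induct[where k = 0]) (simp_all add: even_T_add even_T_diff)
qed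

lemma even_T_vec_mult: "vec_T x * vec_T y \<in> even_T"
proof -
  have gen: "gen i * gen j \<in> even_T" for i j
    using even_T_frag_of[of "[i, j]"] by (simp add: frag_of_Cons[of i "[j]"])
  have "of_int k * gen i * (of_int m * gen j) = of_int (k * m) * (gen i * gen j)" for k m i j
    by (metis (no_types) mult.assoc mult_of_int_commute of_int_mult)
  then show ?thesis
    unfolding vec_T_eq ring_distribs by (simp only: even_T_add even_T_mult even_T_of_int gen)
qed

text \<open>Every monomial of x t has four letters. Hence x t'' lies in the domain of
  \<open>\<phi>\<close>.\<close>

lemma even_T_vec_special: "vec_T x * special_T \<in> even_T"
proof -
  have g: "vec_T x * gen i \<in> even_T" and gg: "gen i * gen j \<in> even_T" for i j
    using even_T_vec_mult[of x "axis i 1"] even_T_vec_mult[of "axis i 1" "axis j 1"]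
    by (simp_all only: vec_T_axis)
  have "vec_T x * gen 1 * (gen 2 * gen 3) - vec_T x * gen 3 * (gen 2 * gen 1) \<in> even_T"
    by (intro even_T_diff even_T_mult g gg)
  then show ?thesis
    by (simp add: special_T_def right_diff_distrib mult.assoc)
qed

section \<open>Homomorphisms of even Clifford algebras\<close>

definition subst_T :: "(int^3 \<Rightarrow> int^3) \<Rightarrow> tensor_alg \<Rightarrow> tensor_alg" where
  "subst_T \<alpha> = frag_extend (\<lambda>w. prod_list (map (\<lambda>i. vec_T (\<alpha> (axis i 1))) w))"

lemma subst_T_linear [simp]:
  "subst_T \<alpha> 0 = 0" "subst_T \<alpha> (g + h) = subst_T \<alpha> g + subst_T \<alpha> h"
  "subst_T \<alpha> (g - h) = subst_T \<alpha> g - subst_T \<alpha> h" "subst_T \<alpha> (- g) = - subst_T \<alpha> g"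
  by (simp_all add: subst_T_def frag_extend_add frag_extend_diff frag_extend_minus)

lemma subst_T_frag_of: "subst_T \<alpha> (frag_of w) = prod_list (map (\<lambda>i. vec_T (\<alpha> (axis i 1))) w)"
  by (simp add: subst_T_def)

lemma subst_T_mult: "subst_T \<alpha> (g * h) = subst_T \<alpha> g * subst_T \<alpha> h"
proof (induction g rule: tensor_alg_induct)
  case (2 v)
  show ?case
  proof (induction h rule: tensor_alg_induct)
    case (2 w)
    show ?case
      unfolding frag_of_append[symmetric] subst_T_frag_of by simp
  qed (simp_all only: subst_T_linear right_diff_distrib mult_zero_right)
qed (simp_all only: subst_T_linear left_diff_distrib mult_zero_left)

lemma subst_T_1: "subst_T \<alpha> 1 = 1"
  using subst_T_frag_of[of \<alpha> "[]"] by (simp add: frag_of_Nil)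

lemma subst_T_of_int: "subst_T \<alpha> (of_int k) = of_int k"
  by (induction k rule: int_induct[where k = 0]) (simp_all add: subst_T_1)

lemma subst_T_vec:
  assumes add: "\<And>x y. \<alpha> (x + y) = \<alpha> x + \<alpha> y" and scale: "\<And>c x. \<alpha> (c *s x) = c *s \<alpha> x"
  shows "subst_T \<alpha> (vec_T x) = vec_T (\<alpha> x)"
proof -
  have gen: "subst_T \<alpha> (gen i) = vec_T (\<alpha> (axis i 1))" for i
    by (simp add: subst_T_frag_of)
  have "x = x $ 1 *s axis 1 1 + x $ 2 *s axis 2 1 + x $ 3 *s axis 3 1"
    using basis_expansion[of x] by (simp add: sum_3)
  then have "vec_T (\<alpha> x) = vec_T (\<alpha> (x $ 1 *s axis 1 1 + x $ 2 *s axis 2 1 + x $ 3 *s axis 3 1))"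
    by simp
  also have "\<dots> = subst_T \<alpha> (vec_T x)"
    unfolding vec_T_eq[of x] add scale vec_T_add vec_T_scale subst_T_linear subst_T_mult subst_T_of_int gen ..
  finally show ?thesis ..
qed

text \<open>Universal property: the preimage of the target ideal under
  \<open>subst_T \<alpha>\<close> is an ideal, and it contains the source relations because \<alpha>
  preserves the forms.\<close>

lemma isometry_lift:
  assumes "isometry q' q \<alpha>"
  shows "\<exists>\<psi>. is_lift q' q \<alpha> \<psi>"
proof -
  have vec: "subst_T \<alpha> (vec_T x) = vec_T (\<alpha> x)" and q: "q (\<alpha> x) = q' x" for x
    using assms by (auto simp: isometry_def intro: subst_T_vec)
  have "ideal {g. subst_T \<alpha> g \<in> cliff_ideal q} T_alg"
    by (rule ideal_T_algI)
       (simp_all add: subst_T_mult cliff_ideal_0 cliff_ideal_add cliff_ideal_mult_left cliff_ideal_mult_right)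
  moreover have "subst_T \<alpha> (vec_T x * vec_T x - of_int (q' x)) \<in> cliff_ideal q" for x
    using cliff_relation[of "\<alpha> x" q] by (simp add: subst_T_mult subst_T_of_int vec q)
  ultimately have ideal: "cliff_ideal q' \<subseteq> {g. subst_T \<alpha> g \<in> cliff_ideal q}"
    by (subst cliff_ideal_def, intro ring.genideal_minimal[OF ring_T_alg]) (auto simp: cliff_ideal_def)
  define \<psi> where "\<psi> S = cliff_class q (subst_T \<alpha> (SOME g. S = cliff_class q' g))" for S
  have \<psi>: "\<psi> (cliff_class q' g) = cliff_class q (subst_T \<alpha> g)" for g
  proof -
    let ?h = "SOME h. cliff_class q' g = cliff_class q' h"
    have "cliff_class q' g = cliff_class q' ?h"
      by (rule someI) (rule refl)
    moreover have "?h \<in> cliff_class q' ?h"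
      unfolding cliff_class_alt using cliff_ideal_0 by force
    ultimately have "?h - g \<in> cliff_ideal q'"
      by (auto simp: cliff_class_alt)
    then have "subst_T \<alpha> ?h - subst_T \<alpha> g \<in> cliff_ideal q"
      using ideal by (auto simp flip: subst_T_linear)
    then show ?thesis
      unfolding \<psi>_def by (rule cliff_class_eqI)
  qed
  have one: "\<one>\<^bsub>cliff p\<^esub> = cliff_class p 1" for p
    using ring_hom_one[OF cliff_class_hom, of p] by simp
  have "\<psi> \<in> ring_hom (cliff q') (cliff q)"
    by (rule ring_hom_memI)
       (auto dest!: carrier_cliff
         simp: \<psi> cliff_class_carrier cliff_class_mult cliff_class_add subst_T_mult one subst_T_1)
  then have "is_lift q' q \<alpha> \<psi>"
    by (simp add: is_lift_def cliff_vec_def \<psi> vec)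
  then show ?thesis by blast
qed

locale ternary_pair =
  src: ternary_form q' a' b' c' d' e' f' + tgt: ternary_form q a b c d e f
  for q' q :: "int^3 \<Rightarrow> int" and a' b' c' d' e' f' a b c d e f :: int
begin

lemma carrier_cliff_coord: "S \<in> carrier (cliff q) \<Longrightarrow> S' \<in> carrier (cliff q) \<Longrightarrow>
    S = S' \<longleftrightarrow> tgt.coord S = tgt.coord S'"
  by (metis carrier_cliff tgt.coord_class tgt.cliff_class_eq_iff)

section \<open>Homomorphisms of the even part in coordinates\<close>

text \<open>Homomorphisms are evaluated on tensor representatives with values in Z^8. Taking all of
  C(E) as codomain treats \<open>\<phi>\<close> and restrictions of lifts alike.\<close>

definition hom_coord :: "(tensor_alg set \<Rightarrow> tensor_alg set) \<Rightarrow> tensor_alg \<Rightarrow> oct" where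
  "hom_coord \<eta> g = tgt.coord (\<eta> (cliff_class q' g))"

lemma hom_coord_cong: "cliff_class q' g = cliff_class q' h \<Longrightarrow> hom_coord \<eta> g = hom_coord \<eta> h"
  by (simp add: hom_coord_def)

context
  fixes \<eta>
  assumes \<eta>: "\<eta> \<in> ring_hom (cliff_even q') (cliff q)"
begin

lemma even_hom_class:
  assumes "g \<in> even_T"
  obtains k where "\<eta> (cliff_class q' g) = cliff_class q k"
  using ring_hom_closed[OF \<eta>, of "cliff_class q' g"] assms
  by (auto simp: carrier_cliff_even dest!: carrier_cliff)

lemma even_hom_carrier: "g \<in> even_T \<Longrightarrow> \<eta> (cliff_class q' g) \<in> carrier (cliff q)"
  using ring_hom_closed[OF \<eta>] by (auto simp: carrier_cliff_even)

lemma hom_coord_eq_iff: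
  "g \<in> even_T \<Longrightarrow> hom_coord \<eta> g = tgt.coord_T k \<longleftrightarrow> \<eta> (cliff_class q' g) = cliff_class q k"
  using carrier_cliff_coord[OF even_hom_carrier cliff_class_carrier, of g k] by (simp add: hom_coord_def)

lemma hom_coord_add:
  assumes "g \<in> even_T" "h \<in> even_T"
  shows "hom_coord \<eta> (g + h) = hom_coord \<eta> g + hom_coord \<eta> h"
proof -
  obtain k l where kl: "\<eta> (cliff_class q' g) = cliff_class q k" "\<eta> (cliff_class q' h) = cliff_class q l"
    using assms by (meson even_hom_class)
  have "\<eta> (cliff_class q' g \<oplus>\<^bsub>cliff_even q'\<^esub> cliff_class q' h) = cliff_class q (k + l)"
    using ring_hom_add[OF \<eta>, of "cliff_class q' g" "cliff_class q' h"] assms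
    by (simp add: carrier_cliff_even kl cliff_class_add)
  then show ?thesis
    by (simp add: hom_coord_def kl cliff_even_def cliff_class_add)
qed

lemma hom_coord_mult:
  assumes "g \<in> even_T" "h \<in> even_T"
  shows "hom_coord \<eta> (g * h) = tgt.oct_mult (hom_coord \<eta> g) (hom_coord \<eta> h)"
proof -
  obtain k l where kl: "\<eta> (cliff_class q' g) = cliff_class q k" "\<eta> (cliff_class q' h) = cliff_class q l"
    using assms by (meson even_hom_class)
  have "\<eta> (cliff_class q' g \<otimes>\<^bsub>cliff_even q'\<^esub> cliff_class q' h) = cliff_class q (k * l)"
    using ring_hom_mult[OF \<eta>, of "cliff_class q' g" "cliff_class q' h"] assms
    by (simp add: carrier_cliff_even kl cliff_class_mult)
  then show ?thesis
    by (simp add: hom_coord_def kl cliff_even_def cliff_class_mult tgt.coord_T_mult)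
qed

lemma hom_coord_diff:
  assumes "g \<in> even_T" "h \<in> even_T"
  shows "hom_coord \<eta> (g - h) = hom_coord \<eta> g - hom_coord \<eta> h"
  using hom_coord_add[OF even_T_diff[OF assms] assms(2)] by (simp add: eq_diff_eq)

lemma hom_coord_of_int: "hom_coord \<eta> (of_int k) = tgt.coord_T (of_int k)"
proof -
  have one: "\<one>\<^bsub>cliff p\<^esub> = cliff_class p 1" for p
    using ring_hom_one[OF cliff_class_hom, of p] by simp
  have 1: "hom_coord \<eta> 1 = tgt.coord_T 1"
    using ring_hom_one[OF \<eta>] by (simp add: hom_coord_def cliff_even_def one)
  have even: "1 \<in> even_T" "of_int i \<in> even_T" for i
    using even_T_of_int[of 1] by (simp_all add: even_T_of_int)
  show ?thesis
  proof (induction k rule: int_induct[where k = 0])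
    case base
    show ?case using hom_coord_diff[OF even(1,1)] by simp
  next
    case (step1 i)
    then show ?case using hom_coord_add[OF even(2,1)] by (simp add: 1)
  next
    case (step2 i)
    then show ?case using hom_coord_diff[OF even(2,1)] by (simp add: 1)
  qed
qed

lemma hom_coord_of_int_mult:
  "g \<in> even_T \<Longrightarrow> hom_coord \<eta> (of_int k * g) = oct_scale k (hom_coord \<eta> g)"
  by (simp only: hom_coord_mult even_T_of_int hom_coord_of_int tgt.coord_T_of_int tgt.oct_mult_of_int)

end

text \<open>An even word is a product of pairs of letters, so the values on e_i e_j determine the
  homomorphism.\<close>

lemma even_hom_eqI:
  assumes \<eta>: "\<eta> \<in> ring_hom (cliff_even q') (cliff q)" and \<eta>': "\<eta>' \<in> ring_hom (cliff_even q') (cliff q)"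
    and gen: "\<And>i j. hom_coord \<eta> (gen i * gen j) = hom_coord \<eta>' (gen i * gen j)"
    and S: "S \<in> carrier (cliff_even q')"
  shows "\<eta> S = \<eta>' S"
proof -
  have word: "hom_coord \<eta> (frag_of w) = hom_coord \<eta>' (frag_of w)" if "even (length w)" for w
    using that
  \<comment> \<open>Two letters are removed at a time; the one-letter case contradicts
    evenness.\<close>
  proof (induction w rule: induct_list012)
    case 1
    show ?case
      using hom_coord_of_int[OF \<eta>, of 1] hom_coord_of_int[OF \<eta>', of 1] by (simp add: frag_of_Nil)
  next
    case (3 i j w)
    have eq: "frag_of (i # j # w) = gen i * gen j * frag_of w"
      by (simp only: frag_of_Cons[of i "j # w"] frag_of_Cons[of j w] mult.assoc)
    have "gen i * gen j \<in> even_T"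
      using even_T_vec_mult[of "axis i 1" "axis j 1"] by (simp only: vec_T_axis)
    moreover have "frag_of w \<in> even_T"
      using 3 by (simp add: even_T_frag_of)
    moreover have "hom_coord \<eta> (frag_of w) = hom_coord \<eta>' (frag_of w)"
      using 3 by simp
    ultimately show ?case
      unfolding eq by (simp only: hom_coord_mult[OF \<eta>] hom_coord_mult[OF \<eta>'] gen)
  qed simp
  obtain g where g: "g \<in> even_T" "S = cliff_class q' g"
    using S by (auto simp: carrier_cliff_even)
  have "g \<in> even_T \<and> hom_coord \<eta> g = hom_coord \<eta>' g"
  proof (rule frag_induction[of g "{w. even (length w)}"])
    show "Poly_Mapping.keys g \<subseteq> {w. even (length w)}"
      using g by (auto simp: even_T_def)
    show "0 \<in> even_T \<and> hom_coord \<eta> 0 = hom_coord \<eta>' 0"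
      using hom_coord_of_int[OF \<eta>, of 0] hom_coord_of_int[OF \<eta>', of 0] even_T_of_int[of 0] by simp
  qed (auto simp: word even_T_frag_of even_T_diff hom_coord_diff[OF \<eta>] hom_coord_diff[OF \<eta>'])
  then show ?thesis
    using carrier_cliff_coord[OF even_hom_carrier[OF \<eta>] even_hom_carrier[OF \<eta>'], of g g] g
    by (simp add: hom_coord_def)
qed

section \<open>Values of a lift on vectors and on the special element\<close>

context
  fixes \<alpha> \<psi>
  assumes lift: "is_lift q' q \<alpha> \<psi>"
begin

lemma lift_hom: "\<psi> \<in> ring_hom (cliff q') (cliff q)"
  using lift by (simp add: is_lift_def)

lemma lift_even_hom: "\<psi> \<in> ring_hom (cliff_even q') (cliff q)"
  by (intro ring_hom_memI)
     (simp_all add: cliff_even_ops subsetD[OF carrier_cliff_even_subset] ring_hom_closed[OF lift_hom]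
       ring_hom_mult[OF lift_hom] ring_hom_add[OF lift_hom] ring_hom_one[OF lift_hom])

lemma lift_class: "\<exists>k. \<psi> (cliff_class q' g) = cliff_class q k"
  by (intro carrier_cliff ring_hom_closed[OF lift_hom] cliff_class_carrier)

lemma lift_mult: "\<psi> (cliff_class q' (g * h)) = \<psi> (cliff_class q' g) \<otimes>\<^bsub>cliff q\<^esub> \<psi> (cliff_class q' h)"
  using ring_hom_mult[OF lift_hom cliff_class_carrier cliff_class_carrier, of g h]
  by (simp add: cliff_class_mult)

lemma lift_vec: "\<psi> (cliff_class q' (vec_T x)) = cliff_class q (vec_T (\<alpha> x))"
  using lift by (simp add: is_lift_def cliff_vec_def)

definition lift_det :: int where
  "lift_det = det_3 (\<alpha> (axis 1 1)) (\<alpha> (axis 2 1)) (\<alpha> (axis 3 1))"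

lemma lift_special: "\<psi> (cliff_class q' special_T) = cliff_class q (of_int lift_det * special_T)"
proof -
  let ?v = "\<lambda>i. vec_T (\<alpha> (axis i 1))"
  have gen: "\<psi> (cliff_class q' (gen i)) = cliff_class q (?v i)" for i
    using lift_vec[of "axis i 1"] by (simp add: vec_T_axis)
  obtain k where k: "\<psi> (cliff_class q' special_T) = cliff_class q k"
    using lift_class by blast
  \<comment> \<open>The subtraction in t'' is rephrased as a sum, so that additivity of
    \<open>\<psi>\<close> applies directly.\<close>
  have "special_T + gen 3 * gen 2 * gen 1 = gen 1 * gen 2 * gen 3"
    by (simp add: special_T_def)
  then have "\<psi> (cliff_class q' special_T \<oplus>\<^bsub>cliff q'\<^esub> cliff_class q' (gen 3 * gen 2 * gen 1))
      = \<psi> (cliff_class q' (gen 1 * gen 2 * gen 3))"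
    by (simp only: cliff_class_add)
  then have "cliff_class q (k + ?v 3 * ?v 2 * ?v 1) = cliff_class q (?v 1 * ?v 2 * ?v 3)"
    unfolding ring_hom_add[OF lift_hom cliff_class_carrier cliff_class_carrier]
    by (simp only: lift_mult gen k cliff_class_add cliff_class_mult)
  then have "cliff_class q k = cliff_class q (?v 1 * ?v 2 * ?v 3 - ?v 3 * ?v 2 * ?v 1)"
    unfolding tgt.cliff_class_eq_iff tgt.coord_T_linear by (simp only: eq_diff_eq)
  then show ?thesis
    unfolding k tgt.triple_alternating lift_det_def .
qed

lemma lift_vec_special:
  "\<psi> (cliff_class q' (vec_T x * special_T)) = cliff_class q (of_int lift_det * (vec_T (\<alpha> x) * special_T))"
  unfolding lift_mult lift_vec lift_special cliff_class_mult
  by (simp only: mult.assoc[symmetric] mult_of_int_commute[of lift_det "vec_T (\<alpha> x)"])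

lemma lift_vec_mult: "\<psi> (cliff_class q' (vec_T x * vec_T y)) = cliff_class q (vec_T (\<alpha> x) * vec_T (\<alpha> y))"
  unfolding lift_mult lift_vec cliff_class_mult ..

text \<open>Applying the lift to t''^2 = - \<Delta>'' gives (D t)^2 = - D^2 \<Delta>, and integers
  are faithfully represented in C(E).\<close>

lemma lift_det_square: "lift_det\<^sup>2 * tgt.delta = src.delta"
proof -
  have "\<psi> (cliff_class q' (of_int (- src.delta))) = cliff_class q (of_int (- src.delta))"
    using hom_coord_of_int[OF lift_even_hom, of "- src.delta"]
    unfolding hom_coord_eq_iff[OF lift_even_hom even_T_of_int] .
  moreover have "\<psi> (cliff_class q' (of_int (- src.delta)))
      = cliff_class q (of_int lift_det * special_T * (of_int lift_det * special_T))"
    unfolding src.special_square[symmetric] lift_mult lift_special cliff_class_mult ..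
  moreover have "of_int lift_det * special_T * (of_int lift_det * special_T)
      = of_int (lift_det\<^sup>2) * (special_T * special_T)"
    by (metis (no_types) mult.assoc mult_of_int_commute of_int_mult power2_eq_square)
  moreover have "cliff_class q (of_int (lift_det\<^sup>2) * (special_T * special_T))
      = cliff_class q (of_int (lift_det\<^sup>2)) \<otimes>\<^bsub>cliff q\<^esub> cliff_class q (special_T * special_T)"
    by (simp only: cliff_class_mult)
  ultimately have "cliff_class q (of_int (- src.delta)) = cliff_class q (of_int (- (lift_det\<^sup>2 * tgt.delta)))"
    unfolding tgt.special_square cliff_class_mult by simp
  then show ?thesis
    unfolding tgt.cliff_class_eq_iff tgt.coord_T_of_int by simp
qed

end
end

section \<open>Homomorphisms that extend to isometries\<close>

lemma oct_complex_mult: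
  assumes "oct_complex w u = oct_complex z v"
  shows "oct_complex (k * w) u = oct_complex (k * z) v"
  using assms
  by (cases "(w, u)" rule: oct_complex.cases; cases "(z, v)" rule: oct_complex.cases)
     (simp add: mult.left_commute)

lemma oct_scale_inj: "oct_scale k u = oct_scale k v \<Longrightarrow> k \<noteq> 0 \<Longrightarrow> u = v"
  by (cases "(k, u)" rule: oct_scale.cases; cases "(k, v)" rule: oct_scale.cases) simp

lemma isometry_uminus: "isometry q' q \<alpha> \<Longrightarrow> ternary_form q a b c d e f \<Longrightarrow> isometry q' q (\<lambda>x. - \<alpha> x)"
  by (auto simp: isometry_def ternary_form.q_eq vec_eq_iff)

lemma mult_of_int_left_commute: "of_int m * x * (of_int n * y) = of_int (m * n) * (x * y)"
  for x y :: "'a::ring_1"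
  by (metis (no_types) mult.assoc mult_of_int_commute of_int_mult)

locale even_clifford_hom = ternary_pair +
  fixes \<phi> :: "tensor_alg set \<Rightarrow> tensor_alg set"
  assumes \<phi>: "\<phi> \<in> ring_hom (cliff_even q') (cliff q)"
    and src_delta: "src.delta \<noteq> 0" and tgt_delta: "tgt.delta \<noteq> 0"
begin

lemma restricts_vec_special:
  assumes "restricts_lift q' q \<phi> \<alpha>"
  shows "\<phi> (cliff_class q' (vec_T x * special_T))
      = cliff_class q (of_int (lift_det \<alpha>) * (vec_T (\<alpha> x) * special_T))"
proof -
  obtain \<psi> where \<psi>: "is_lift q' q \<alpha> \<psi>" "\<And>c. c \<in> carrier (cliff_even q') \<Longrightarrow> \<phi> c = \<psi> c"
    using assms by (auto simp: restricts_lift_def)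
  show ?thesis
    using lift_vec_special[OF \<psi>(1)] \<psi>(2) by (simp add: carrier_cliff_even even_T_vec_special)
qed

lemma restricts_det_square:
  assumes "restricts_lift q' q \<phi> \<alpha>"
  shows "(lift_det \<alpha>)\<^sup>2 * tgt.delta = src.delta"
  using assms lift_det_square by (auto simp: restricts_lift_def)

text \<open>Agreement on products of two vectors suffices, since the e_i e_j generate the even
  part.\<close>

lemma restricts_liftI:
  assumes "is_lift q' q \<alpha> \<psi>"
    and "\<And>x y. \<phi> (cliff_class q' (vec_T x * vec_T y)) = cliff_class q (vec_T (\<alpha> x) * vec_T (\<alpha> y))"
  shows "restricts_lift q' q \<phi> \<alpha>"
proof -
  have "hom_coord \<phi> (gen i * gen j) = hom_coord \<psi> (gen i * gen j)" for i j
    using assms(2)[of "axis i 1" "axis j 1"] lift_vec_mult[OF assms(1), of "axis i 1" "axis j 1"]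
    by (simp only: hom_coord_def vec_T_axis)
  then show ?thesis
    using even_hom_eqI[OF \<phi> lift_even_hom[OF assms(1)]] assms(1) by (auto simp: restricts_lift_def)
qed

lemma restricts_vec_mult:
  assumes "restricts_lift q' q \<phi> \<alpha>"
  shows "\<phi> (cliff_class q' (vec_T x * vec_T y)) = cliff_class q (vec_T (\<alpha> x) * vec_T (\<alpha> y))"
proof -
  obtain \<psi> where \<psi>: "is_lift q' q \<alpha> \<psi>" "\<And>c. c \<in> carrier (cliff_even q') \<Longrightarrow> \<phi> c = \<psi> c"
    using assms by (auto simp: restricts_lift_def)
  show ?thesis
    using lift_vec_mult[OF \<psi>(1)] \<psi>(2) by (simp add: carrier_cliff_even even_T_vec_mult)
qed

text \<open>The sign cancels in every product of two vectors, so \<alpha> and - \<alpha> induce the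
  same map on the even part.\<close>

lemma restricts_uminus:
  assumes "isometry q' q \<alpha>" "restricts_lift q' q \<phi> \<alpha>"
  shows "isometry q' q (\<lambda>x. - \<alpha> x)" "restricts_lift q' q \<phi> (\<lambda>x. - \<alpha> x)"
proof -
  show iso: "isometry q' q (\<lambda>x. - \<alpha> x)"
    using isometry_uminus[OF assms(1)] tgt.ternary_form_axioms by blast
  then obtain \<psi> where "is_lift q' q (\<lambda>x. - \<alpha> x) \<psi>"
    using isometry_lift by blast
  then show "restricts_lift q' q \<phi> (\<lambda>x. - \<alpha> x)"
    by (rule restricts_liftI) (simp add: restricts_vec_mult[OF assms(2)] vec_T_uminus)
qed

text \<open>The value of \<open>\<phi>\<close> at x t'' determines det(\<alpha>) \<alpha>(x), and
  the square of det(\<alpha>) is fixed by \<Delta>'' and \<Delta>; only a sign remains free.\<close>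

lemma restricts_unique:
  assumes \<alpha>: "isometry q' q \<alpha>" "restricts_lift q' q \<phi> \<alpha>"
    and \<beta>: "isometry q' q \<beta>" "restricts_lift q' q \<phi> \<beta>"
  shows "\<beta> = \<alpha> \<or> \<beta> = (\<lambda>x. - \<alpha> x)"
proof -
  have eq: "lift_det \<beta> *s \<beta> x = lift_det \<alpha> *s \<alpha> x" for x
  proof (rule tgt.vec_special_inj[OF tgt_delta])
    have "cliff_class q (of_int (lift_det \<beta>) * (vec_T (\<beta> x) * special_T))
        = cliff_class q (of_int (lift_det \<alpha>) * (vec_T (\<alpha> x) * special_T))"
      using restricts_vec_special[OF \<alpha>(2)] restricts_vec_special[OF \<beta>(2)] by metis
    then show "tgt.coord_T (vec_T (lift_det \<beta> *s \<beta> x) * special_T)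
        = tgt.coord_T (vec_T (lift_det \<alpha> *s \<alpha> x) * special_T)"
      by (simp only: tgt.cliff_class_eq_iff vec_T_scale mult.assoc)
  qed
  have nz: "lift_det \<alpha> \<noteq> 0" and "(lift_det \<beta>)\<^sup>2 = (lift_det \<alpha>)\<^sup>2"
    using restricts_det_square[OF \<alpha>(2)] restricts_det_square[OF \<beta>(2)] src_delta tgt_delta
    by (auto, metis mult_right_cancel)
  then consider "lift_det \<beta> = lift_det \<alpha>" | "lift_det \<beta> = - lift_det \<alpha>"
    by (auto simp: power2_eq_iff)
  then show ?thesis
  proof cases
    case 1
    then show ?thesis using eq nz by (simp add: vec_eq_iff fun_eq_iff)
  next
    case 2
    have "\<beta> x $ i = - \<alpha> x $ i" for x i
    proof -
      have "lift_det \<alpha> * (\<beta> x $ i + \<alpha> x $ i) = 0"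
        using arg_cong[OF eq[of x], of "\<lambda>v. v $ i"] 2 by (simp add: ring_distribs)
      then show ?thesis using nz by simp
    qed
    then show ?thesis by (simp add: vec_eq_iff fun_eq_iff)
  qed
qed

lemma restricts_tensor:
  assumes "restricts_lift q' q \<phi> \<alpha>" and r: "r\<^sup>2 * of_int tgt.delta = of_int src.delta"
  shows "\<exists>y. tensor (cliff q) (\<phi> (cliff_class q' (vec_T x * special_T))) 1
    = tensor (cliff q) (cliff_class q (vec_T y * special_T)) r"
proof -
  let ?D = "lift_det \<alpha>"
  have "r\<^sup>2 * of_int tgt.delta = (of_int ?D)\<^sup>2 * of_int tgt.delta"
    unfolding r restricts_det_square[OF assms(1), symmetric] by simp
  then have "of_int ?D = r \<or> of_int ?D = - r"
    using tgt_delta by (auto simp: power2_eq_iff)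
  \<comment> \<open>The sign \<open>s\<close> records which of the two square roots r is, so the
    required vector y is s \<alpha>(x).\<close>
  then obtain s :: int where s: "s = 1 \<or> s = - 1" "of_int ?D = of_int s * r"
    by (metis mult_1 mult_minus1 of_int_1 of_int_minus)
  have "of_int s * (vec_T (\<alpha> x) * special_T) = vec_T (s *s \<alpha> x) * special_T"
    by (simp only: vec_T_scale mult.assoc)
  then have "tensor (cliff q) (\<phi> (cliff_class q' (vec_T x * special_T))) 1
    = tensor (cliff q) (cliff_class q (vec_T (s *s \<alpha> x) * special_T)) r"
    unfolding restricts_vec_special[OF assms(1)] tensor_of_int
    using tensor_of_int[of q s "vec_T (\<alpha> x) * special_T" r] s by simp
  then show ?thesis ..
qed

text \<open>Here \<phi>(x t'') t = D \<alpha>(x) t^2 = - D \<Delta> \<alpha>(x), and - D \<Delta> is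
  a square root of \<Delta> \<Delta>''. The sign \<open>s\<close> is therefore the same for all
  x.\<close>

lemma restricts_formula:
  assumes "restricts_lift q' q \<phi> \<alpha>" and \<rho>: "\<rho>\<^sup>2 = of_int (tgt.delta * src.delta)"
  obtains s :: int where "s = 1 \<or> s = - 1" and
    "\<And>x z. tensor (cliff q) (\<phi> (cliff_class q' (vec_T x * special_T)) \<otimes>\<^bsub>cliff q\<^esub> cliff_class q special_T) (z / \<rho>)
      = tensor (cliff q) (cliff_class q (vec_T (\<alpha> x))) (of_int s * z)"
proof -
  let ?D = "lift_det \<alpha>"
  have "(of_int (- (?D * tgt.delta)))\<^sup>2 = \<rho>\<^sup>2"
    unfolding \<rho> restricts_det_square[OF assms(1), symmetric] by (simp add: power2_eq_square)
  then have "of_int (- (?D * tgt.delta)) = \<rho> \<or> of_int (- (?D * tgt.delta)) = - \<rho>"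
    by (simp only: power2_eq_iff)
  then obtain s :: int where s: "s = 1 \<or> s = - 1" "of_int (- (?D * tgt.delta)) = of_int s * \<rho>"
    by (metis mult_1 mult_minus1 of_int_1 of_int_minus)
  have nz: "\<rho> \<noteq> 0"
    using \<rho> src_delta tgt_delta by auto
  have "\<phi> (cliff_class q' (vec_T x * special_T)) \<otimes>\<^bsub>cliff q\<^esub> cliff_class q special_T
      = cliff_class q (of_int (- (?D * tgt.delta)) * vec_T (\<alpha> x))" for x
  proof -
    have "\<phi> (cliff_class q' (vec_T x * special_T)) \<otimes>\<^bsub>cliff q\<^esub> cliff_class q special_T
        = cliff_class q (of_int ?D) \<otimes>\<^bsub>cliff q\<^esub> cliff_class q (vec_T (\<alpha> x) * special_T * special_T)"
      unfolding restricts_vec_special[OF assms(1)] cliff_class_mult by (simp only: mult.assoc)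
    then show ?thesis
      unfolding tgt.vec_special_special cliff_class_mult by (simp add: mult.assoc)
  qed
  then have "tensor (cliff q) (\<phi> (cliff_class q' (vec_T x * special_T)) \<otimes>\<^bsub>cliff q\<^esub> cliff_class q special_T) (z / \<rho>)
      = tensor (cliff q) (cliff_class q (vec_T (\<alpha> x))) (of_int s * z)" for x z
    using nz by (simp only: tensor_of_int s(2)) simp
  with s(1) show ?thesis by (rule that)
qed

lemma tensor_restricts:
  assumes sub: "\<And>x. \<exists>y. tensor (cliff q) (\<phi> (cliff_class q' (vec_T x * special_T))) 1
      = tensor (cliff q) (cliff_class q (vec_T y * special_T)) r"
    and r: "r\<^sup>2 * of_int tgt.delta = of_int src.delta"
  shows "\<exists>\<alpha>. isometry q' q \<alpha> \<and> restricts_lift q' q \<phi> \<alpha>"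
proof -
  let ?P = "\<lambda>x. hom_coord \<phi> (vec_T x * special_T)"
  let ?M = "\<lambda>y. tgt.coord_T (vec_T y * special_T)"
  \<comment> \<open>The vectors y are chosen pointwise; linearity is forced below by injectivity of
    y \<mapsto> r y t.\<close>
  obtain \<alpha> where "\<And>x. tensor (cliff q) (\<phi> (cliff_class q' (vec_T x * special_T))) 1
      = tensor (cliff q) (cliff_class q (vec_T (\<alpha> x) * special_T)) r"
    using sub by metis
  then have \<alpha>: "oct_complex 1 (?P x) = oct_complex r (?M (\<alpha> x))" for x
    using tgt.tensor_cliff_eqD even_hom_class[OF \<phi> even_T_vec_special, of x]
    by (metis hom_coord_def tgt.coord_class)
  have r0: "r \<noteq> 0"
    using r src_delta by auto
  have inj: "x = y" if "oct_complex r (?M x) = oct_complex r (?M y)" for x y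
    using tgt.vec_special_inj[OF tgt_delta oct_complex_inj[OF that r0]] .
  have "\<alpha> (x + y) = \<alpha> x + \<alpha> y" for x y
  proof (rule inj)
    have "?P (x + y) = ?P x + ?P y"
      by (simp only: vec_T_add ring_distribs hom_coord_add[OF \<phi> even_T_vec_special even_T_vec_special])
    moreover have "?M (\<alpha> x + \<alpha> y) = ?M (\<alpha> x) + ?M (\<alpha> y)"
      by (simp only: vec_T_add ring_distribs tgt.coord_T_linear)
    ultimately show "oct_complex r (?M (\<alpha> (x + y))) = oct_complex r (?M (\<alpha> x + \<alpha> y))"
      by (simp only: oct_complex_add \<alpha>[symmetric])
  qed
  moreover have "\<alpha> (k *s x) = k *s \<alpha> x" for k x
  proof (rule inj)
    have "?P (k *s x) = oct_scale k (?P x)"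
      by (simp only: vec_T_scale mult.assoc hom_coord_of_int_mult[OF \<phi> even_T_vec_special])
    then have "oct_complex r (?M (\<alpha> (k *s x))) = oct_complex (of_int k) (?P x)"
      unfolding \<alpha>[symmetric] by (simp only: oct_complex_scale mult_1_right)
    also have "\<dots> = oct_complex (of_int k * r) (?M (\<alpha> x))"
      using oct_complex_mult[OF \<alpha>[of x], of "of_int k"] by simp
    also have "\<dots> = oct_complex r (?M (k *s \<alpha> x))"
      by (simp only: vec_T_scale mult.assoc tgt.coord_T_of_int_mult oct_complex_scale)
    finally show "oct_complex r (?M (\<alpha> (k *s x))) = oct_complex r (?M (k *s \<alpha> x))" .
  qed
  moreover have "q (\<alpha> x) = q' x" for x
  proof -
    \<comment> \<open>The scalar part of the square of \<phi>(x t'') is computed twice: as - q'(x)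
      \<Delta>'' in the source, and as - r^2 q(\<alpha>(x)) \<Delta> in the target.\<close>
    have "tgt.oct_mult (?P x) (?P x) = hom_coord \<phi> (vec_T x * special_T * (vec_T x * special_T))"
      by (simp only: hom_coord_mult[OF \<phi> even_T_vec_special even_T_vec_special])
    also have "\<dots> = tgt.coord_T (of_int (- (q' x * src.delta)))"
      unfolding hom_coord_cong[OF src.vec_special_square] hom_coord_of_int[OF \<phi>] ..
    finally have 1: "fst (tgt.oct_mult (?P x) (?P x)) = - (q' x * src.delta)"
      unfolding tgt.coord_T_of_int by simp
    have "tgt.oct_mult (?M (\<alpha> x)) (?M (\<alpha> x)) = tgt.coord_T (of_int (- (q (\<alpha> x) * tgt.delta)))"
      using tgt.vec_special_square[of "\<alpha> x"] unfolding tgt.cliff_class_eq_iff tgt.coord_T_mult .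
    then have 2: "fst (tgt.oct_mult (?M (\<alpha> x)) (?M (\<alpha> x))) = - (q (\<alpha> x) * tgt.delta)"
      unfolding tgt.coord_T_of_int by simp
    have "complex_of_int (q' x) * of_int src.delta = r\<^sup>2 * of_int tgt.delta * of_int (q (\<alpha> x))"
      using tgt.oct_complex_square[OF \<alpha>[of x]] unfolding 1 2 by (simp add: mult_ac)
    then show ?thesis
      unfolding r using src_delta by simp
  qed
  ultimately have iso: "isometry q' q \<alpha>"
    by (simp add: isometry_def)
  then obtain \<psi> where \<psi>: "is_lift q' q \<alpha> \<psi>"
    using isometry_lift by blast
  let ?D = "lift_det \<alpha>"
  \<comment> \<open>Now that a lift exists, its determinant D also satisfies D^2 \<Delta> =
    \<Delta>''. Hence the complex number r is an integer m = \<plusminus> D, and the equations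
    descend to Z^8.\<close>
  have "r\<^sup>2 * of_int tgt.delta = (of_int ?D)\<^sup>2 * of_int tgt.delta"
    unfolding r lift_det_square[OF \<psi>, symmetric] by simp
  then have "r = of_int ?D \<or> r = - of_int ?D"
    using tgt_delta by (auto simp: power2_eq_iff)
  then obtain m :: int where m: "r = of_int m" "m = ?D \<or> m = - ?D"
    by (metis of_int_minus)
  have m2: "m * m * tgt.delta = src.delta"
    using m(2) lift_det_square[OF \<psi>] by (auto simp: power2_eq_square)
  have "?P x = oct_scale m (?M (\<alpha> x))" for x
    by (rule oct_complex_inj[of 1]) (simp_all only: \<alpha> m oct_complex_scale mult_1_right one_neq_zero not_False_eq_True)
  then have P: "?P x = tgt.coord_T (of_int m * (vec_T (\<alpha> x) * special_T))" for x
    by (simp only: tgt.coord_T_of_int_mult)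
  have "\<phi> (cliff_class q' (vec_T x * vec_T y)) = cliff_class q (vec_T (\<alpha> x) * vec_T (\<alpha> y))" for x y
  proof -
    \<comment> \<open>Both factors x t'' and y t'' contribute m, and m^2 \<Delta> = \<Delta>'' hides
      its sign. Cancelling the nonzero scalar - \<Delta>'' is possible since Z^8 is torsion
      free.\<close>
    have "oct_scale (- src.delta) (hom_coord \<phi> (vec_T x * vec_T y))
        = hom_coord \<phi> (of_int (- src.delta) * (vec_T x * vec_T y))"
      by (simp only: hom_coord_of_int_mult[OF \<phi> even_T_vec_mult])
    also have "\<dots> = hom_coord \<phi> (vec_T x * special_T * (vec_T y * special_T))"
      by (rule hom_coord_cong[OF src.vec_special_mult, symmetric])
    also have "\<dots> = tgt.coord_T (of_int m * (vec_T (\<alpha> x) * special_T) * (of_int m * (vec_T (\<alpha> y) * special_T)))"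
      by (simp only: hom_coord_mult[OF \<phi> even_T_vec_special even_T_vec_special] P tgt.coord_T_mult)
    also have "\<dots> = oct_scale (m * m) (tgt.coord_T (vec_T (\<alpha> x) * special_T * (vec_T (\<alpha> y) * special_T)))"
      by (simp only: mult_of_int_left_commute tgt.coord_T_of_int_mult)
    also have "\<dots> = oct_scale (m * m) (oct_scale (- tgt.delta) (tgt.coord_T (vec_T (\<alpha> x) * vec_T (\<alpha> y))))"
      using tgt.vec_special_mult[of "\<alpha> x" "\<alpha> y"]
      by (simp only: tgt.cliff_class_eq_iff tgt.coord_T_of_int_mult)
    also have "\<dots> = oct_scale (- src.delta) (tgt.coord_T (vec_T (\<alpha> x) * vec_T (\<alpha> y)))"
      by (simp only: Modules.module.scale_scale[OF module_oct_scale] m2 mult_minus_right)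
    finally have "hom_coord \<phi> (vec_T x * vec_T y) = tgt.coord_T (vec_T (\<alpha> x) * vec_T (\<alpha> y))"
      using src_delta oct_scale_inj by simp
    then show ?thesis
      by (simp only: hom_coord_eq_iff[OF \<phi> even_T_vec_mult])
  qed
  then have "restricts_lift q' q \<phi> \<alpha>"
    by (rule restricts_liftI[OF \<psi>])
  with iso show ?thesis by blast
qed

end

lemma cliff_vec_special:
  "cliff_vec q x \<otimes>\<^bsub>cliff q\<^esub> special_elt q = cliff_class q (vec_T x * special_T)"
  by (simp add: cliff_vec_def special_elt_eq cliff_class_mult)

theorem theorem5p2:
  fixes q'' q :: "int^3 \<Rightarrow> int" and Q'' Q :: "int^3^3"
    and \<phi> :: "tensor_alg set \<Rightarrow> tensor_alg set"
  assumes "gram_matrix q'' Q''" and "det Q'' \<noteq> 0"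
    and "gram_matrix q Q" and "det Q \<noteq> 0"
    and "\<phi> \<in> ring_hom (cliff_even q'') (cliff_even q)"
  shows
    "((\<exists>\<alpha>. isometry q'' q \<alpha> \<and> restricts_lift q'' q \<phi> \<alpha>) \<longleftrightarrow>
        (\<lambda>x. tensor (cliff q) (\<phi> (cliff_vec q'' x \<otimes>\<^bsub>cliff q''\<^esub> special_elt q'')) 1) ` UNIV
        \<subseteq> (\<lambda>y. tensor (cliff q) (cliff_vec q y \<otimes>\<^bsub>cliff q\<^esub> special_elt q)
                  (csqrt (half_det Q'' / half_det Q))) ` UNIV) \<and>
     ((\<exists>\<alpha>. isometry q'' q \<alpha> \<and> restricts_lift q'' q \<phi> \<alpha>) \<longrightarrow>
        (\<forall>s\<in>{1, - 1}. \<exists>\<alpha>.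
           {\<beta>. isometry q'' q \<beta> \<and> restricts_lift q'' q \<phi> \<beta>} = {\<alpha>, \<lambda>x. - \<alpha> x} \<and>
           (\<forall>x. tensor (cliff q) (cliff_vec q (\<alpha> x)) 1 =
                tensor (cliff q)
                  (\<phi> (cliff_vec q'' x \<otimes>\<^bsub>cliff q''\<^esub> special_elt q'') \<otimes>\<^bsub>cliff q\<^esub> special_elt q)
                  (s / csqrt (half_det Q * half_det Q'')))))"
proof -
  obtain a' b' c' d' e' f' where src: "ternary_form q'' a' b' c' d' e' f'"
      and det'': "det Q'' = 2 * ternary_form.delta a' b' c' d' e' f'"
    using assms(1) by (rule gram_matrix_ternary_form)
  obtain a b c d e f where tgt: "ternary_form q a b c d e f"
      and det: "det Q = 2 * ternary_form.delta a b c d e f"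
    using assms(3) by (rule gram_matrix_ternary_form)
  interpret ternary_pair q'' q a' b' c' d' e' f' a b c d e f
    using src tgt by (rule ternary_pair.intro)
  \<comment> \<open>The codomain is enlarged from C_0(E) to C(E), where lifts take their
    values.\<close>
  have "\<phi> \<in> ring_hom (cliff_even q'') (cliff q)"
    using ring_hom_closed[OF assms(5)] ring_hom_mult[OF assms(5)] ring_hom_add[OF assms(5)] ring_hom_one[OF assms(5)]
    by (intro ring_hom_memI) (simp_all add: cliff_even_ops subsetD[OF carrier_cliff_even_subset])
  then interpret even_clifford_hom q'' q a' b' c' d' e' f' a b c d e f \<phi>
    using assms(2,4) det'' det by unfold_locales auto
  have half: "half_det Q'' = of_int src.delta" "half_det Q = of_int tgt.delta"
    by (simp_all add: half_det_def det'' det)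
  \<comment> \<open>Only the squares of the two principal roots enter the argument, so the choice of
    branch does not matter.\<close>
  have r: "(csqrt (half_det Q'' / half_det Q))\<^sup>2 * of_int tgt.delta = of_int src.delta"
    using tgt_delta by (simp add: half)
  have \<rho>: "(csqrt (half_det Q * half_det Q''))\<^sup>2 = of_int (tgt.delta * src.delta)"
    by (simp add: half)
  have criterion: "(\<exists>\<alpha>. isometry q'' q \<alpha> \<and> restricts_lift q'' q \<phi> \<alpha>) \<longleftrightarrow>
      (\<forall>x. \<exists>y. tensor (cliff q) (\<phi> (cliff_class q'' (vec_T x * special_T))) 1
        = tensor (cliff q) (cliff_class q (vec_T y * special_T)) (csqrt (half_det Q'' / half_det Q)))"
    using restricts_tensor[OF _ r] tensor_restricts[OF _ r] by blast
  have formula: "\<exists>\<beta>. {\<beta>. isometry q'' q \<beta> \<and> restricts_lift q'' q \<phi> \<beta>} = {\<beta>, \<lambda>x. - \<beta> x} \<and>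
      (\<forall>x. tensor (cliff q) (cliff_class q (vec_T (\<beta> x))) 1 =
        tensor (cliff q) (\<phi> (cliff_class q'' (vec_T x * special_T)) \<otimes>\<^bsub>cliff q\<^esub> cliff_class q special_T)
          (s / csqrt (half_det Q * half_det Q'')))"
    if \<alpha>: "isometry q'' q \<alpha>" "restricts_lift q'' q \<phi> \<alpha>" and s: "s \<in> {1, - 1}" for \<alpha> s
  proof -
    obtain s' :: int where s': "s' = 1 \<or> s' = - 1"
      and eq: "\<And>x z. tensor (cliff q) (\<phi> (cliff_class q'' (vec_T x * special_T)) \<otimes>\<^bsub>cliff q\<^esub> cliff_class q special_T)
          (z / csqrt (half_det Q * half_det Q'')) = tensor (cliff q) (cliff_class q (vec_T (\<alpha> x))) (of_int s' * z)"
      using restricts_formula[OF \<alpha>(2) \<rho>] by metis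
    have set: "{\<beta>. isometry q'' q \<beta> \<and> restricts_lift q'' q \<phi> \<beta>} = {\<alpha>, \<lambda>x. - \<alpha> x}"
      using restricts_unique[OF \<alpha>] restricts_uminus[OF \<alpha>] \<alpha> by blast
    have neg: "tensor (cliff q) (cliff_class q (vec_T (- \<alpha> x))) 1
        = tensor (cliff q) (cliff_class q (vec_T (\<alpha> x))) (- 1)" for x
      using tensor_of_int[of q "- 1" "vec_T (\<alpha> x)" 1] by (simp add: vec_T_uminus)
    \<comment> \<open>If the sign \<open>s'\<close> belonging to \<alpha> differs from the
      prescribed \<open>s\<close>, then - \<alpha> is the isometry required; the solution set is
      symmetric under negation.\<close>
    consider "of_int s' * s = 1" | "of_int s' * s = - 1"
      using s s' by auto
    then show ?thesis
    proof cases
      case 1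
      then show ?thesis using set by (intro exI[of _ \<alpha>]) (simp add: eq)
    next
      case 2
      then show ?thesis using set
        by (intro exI[of _ "\<lambda>x. - \<alpha> x"]) (simp add: eq neg insert_commute)
    qed
  qed
  have range: "range F \<subseteq> range G \<longleftrightarrow> (\<forall>x. \<exists>y. F x = G y)" for F G :: "int^3 \<Rightarrow> ((tensor_alg set \<times> complex) \<Rightarrow>\<^sub>0 int) set"
    by (simp add: image_subset_iff image_iff)
  \<comment> \<open>Products x t are rewritten first, so that \<open>special_elt_eq\<close> meets
    only the isolated factor t of the formula.\<close>
  show ?thesis
    unfolding cliff_vec_special unfolding special_elt_eq cliff_vec_def range
    by (intro conjI criterion impI ballI; elim exE conjE; rule formula)
qed

end
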